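(* Let $\mathbb P$ be a probability measure on $\Omega_+$ under which $(\omega(x))_{x\ge0}$ is stationary and ergodic. Then $P_0$-a.s. \[\lim_{n\to\infty}\frac{X_n}{n}=v:=\frac1u\ge0,\qquad u:=\sum_{j\ge1}P_0[T_{j+1}-T_j\ge j]\in[1,\infty],\] with the convention $1/\infty=0$.
   Context: Cookie environments: $\Omega_+=([1/2,1]^{\mathbb N})^{\mathbb Z}$, $\omega(x)=(\omega(x,i))_{i\ge1}$. $P_{x,\omega}$ is the law of the nearest-neighbor process $(X_n)_{n\ge0}$ with $X_0=x$ which, on its $i$-th visit to site $z$, jumps to $z+1$ with probability $\omega(z,i)$ and to $z-1$ otherwise. Annealed measure $P_x[\cdot]=\mathbb E[P_{x,\omega}[\cdot]]$. $T_k=\inf\{n\ge0:X_n=k\}$. *)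

theory Defs
  imports "HOL-Probability.Probability"
begin

type_synonym env = "int \<Rightarrow> nat \<Rightarrow> real"

text \<open>Measurable space of environments (omega(x,i)), x in Z, i in N (index 0 unused).\<close>
definition env_space :: "env measure" where
  "env_space = Pi\<^sub>M UNIV (\<lambda>_::int. Pi\<^sub>M UNIV (\<lambda>_::nat. (borel :: real measure)))"

definition seq_space :: "(nat \<Rightarrow> nat \<Rightarrow> real) measure" where
  "seq_space = Pi\<^sub>M UNIV (\<lambda>_::nat. Pi\<^sub>M UNIV (\<lambda>_::nat. (borel :: real measure)))"

definition seq_shift :: "(nat \<Rightarrow> 'a) \<Rightarrow> (nat \<Rightarrow> 'a)" where
  "seq_shift f = (\<lambda>n. f (Suc n))"

definition right_part :: "env \<Rightarrow> (nat \<Rightarrow> nat \<Rightarrow> real)" where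
  "right_part \<omega> = (\<lambda>n. \<omega> (int n))"

definition stationary_ergodic_right :: "env measure \<Rightarrow> bool" where
  "stationary_ergodic_right Pe \<longleftrightarrow>
     distr Pe seq_space (seq_shift \<circ> right_part) = distr Pe seq_space right_part \<and>
     (\<forall>A \<in> sets seq_space. seq_shift -` A \<inter> space seq_space = A \<longrightarrow>
        measure Pe (right_part -` A \<inter> space Pe) \<in> {0, 1})"

text \<open>Cookie walk driven by uniforms u: on its k-th visit (k>=1) to y at time n,
  it steps to y+1 iff u n < omega(y,k). The path X_0..X_n as a list.\<close>
fun cpath :: "env \<Rightarrow> (nat \<Rightarrow> real) \<Rightarrow> int \<Rightarrow> nat \<Rightarrow> int list" where
  "cpath \<omega> u x 0 = [x]"
| "cpath \<omega> u x (Suc n) =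
     (let p = cpath \<omega> u x n; y = last p; k = count_list p y
      in p @ [if u n < \<omega> y k then y + 1 else y - 1])"

definition cwalk :: "env \<Rightarrow> (nat \<Rightarrow> real) \<Rightarrow> int \<Rightarrow> nat \<Rightarrow> int" where
  "cwalk \<omega> u x n = last (cpath \<omega> u x n)"

definition hit :: "(nat \<Rightarrow> int) \<Rightarrow> int \<Rightarrow> enat" where
  "hit X k = (if \<exists>n. X n = k then enat (LEAST n. X n = k) else \<infinity>)"

definition unif_seq :: "(nat \<Rightarrow> real) measure" where
  "unif_seq = Pi\<^sub>M UNIV (\<lambda>_::nat. uniform_measure lborel {0..1::real})"

definition annealed :: "env measure \<Rightarrow> (env \<times> (nat \<Rightarrow> real)) measure" where
  "annealed Pe = Pe \<Otimes>\<^sub>M unif_seq"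

end

theory Submission
  imports Defs
begin

text \<open>
  Drive the walk by uniform variables attached to (site, visit) instead of to time; this does not
  change its law. Then the number of visits to a site \<open>x \<ge> 0\<close> before \<open>T k\<close>, the first visit to \<open>k\<close>,
  is a function \<open>V (k - x)\<close> of the cookies and uniforms to the right of \<open>x\<close> only, and \<open>V m\<close> increases with \<open>m\<close>.
  Up to the time spent at negative sites, \<open>T k\<close> is the sum over \<open>x < k\<close> of \<open>V (k - x)\<close> shifted by \<open>x\<close>,
  so the ergodic theorem gives \<open>T k / k \<longlonglongrightarrow> sup_m E (V m)\<close>.

  The expected time spent at nonnegative sites between \<open>T k\<close> and \<open>T (k + 1)\<close> telescopes to \<open>E (V (k + 1))\<close>.
  Since a path which goes from \<open>k\<close> to a site below \<open>k - j\<close> and on to \<open>k + 1\<close> has spent at least \<open>j\<close> steps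
  in between, whether this time is at least \<open>j \<le> k\<close> is decided at the sites \<open>k - j, \<dots>, k\<close>; by stationarity
  this event has the same probability for all \<open>k \<ge> j\<close>, and the supremum equals \<open>u\<close>.

  Levels are hit in finite time and \<open>X n / n\<close> has nonnegative lower limit because \<open>X\<close>
  dominates the simple random walk driven by the same uniforms.
\<close>

section \<open>Steered nearest-neighbour paths\<close>

text \<open>Site-indexed uniforms let the spatial shift act on the randomness: with time-indexed
  ones the arrow at a site depends on when it is visited, and stationarity in space is not visible.
  Joint ergodicity of cookies and uniforms is then not automatic, since a product of two ergodic
  systems need not be ergodic; it holds because the uniforms are i.i.d., so that a 0-1 law applies
  to sections.

  The sum for \<open>T k\<close> is not a Birkhoff sum, as its summand at \<open>x\<close> depends
  on \<open>k - x\<close>. It lies between Birkhoff sums: of \<open>sup_m V m\<close> from above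
  and, after dropping the last \<open>m\<close> sites, of \<open>min (V m) c\<close> from below. The
  truncation makes the ergodic theorem for integrable functions applicable even if \<open>u\<close>
  is infinite.

  At negative sites only the bounds on the cookies are known. For finite \<open>u\<close> the site
  \<open>0\<close> is visited finitely often, so the time below it is bounded; for infinite
  \<open>u\<close> that time does no harm, as \<open>T k\<close> is only bounded from below. But
  long waiting times then leave room for deep excursions to the left, so the lower bound on
  \<open>X n / n\<close> has to come from elsewhere.\<close>

definition visits :: "(nat \<Rightarrow> int) \<Rightarrow> int \<Rightarrow> nat \<Rightarrow> nat" where
  "visits y x n = card {m. m < n \<and> y m = x}"

lemma visits_0 [simp]: "visits y x 0 = 0"
  by (simp add: visits_def)

lemma card_Suc_filter:
  "card {m. m < Suc n \<and> P m} = card {m. m < n \<and> P m} + (if P n then 1 else 0)"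
proof -
  have "{m. m < Suc n \<and> P m} = {m. m < n \<and> P m} \<union> (if P n then {n} else {})"
    by (auto simp: less_Suc_eq)
  then show ?thesis by auto
qed

lemma visits_Suc: "visits y x (Suc n) = visits y x n + (if y n = x then 1 else 0)"
  unfolding visits_def by (rule card_Suc_filter)

lemma visits_eq_count_list: "visits y x n = count_list (map y [0..<n]) x"
  by (induction n) (auto simp: visits_Suc)

text \<open>The rule sees time, site and visit number, so both drivings are instances: one consults
  a uniform indexed by time, the other one indexed by site and visit.\<close>

fun rpath :: "(nat \<Rightarrow> int \<Rightarrow> nat \<Rightarrow> bool) \<Rightarrow> nat \<Rightarrow> int list" where
  "rpath r 0 = [0]"
| "rpath r (Suc n) =
     (let p = rpath r n; y = last p
      in p @ [if r n y (count_list p y) then y + 1 else y - 1])"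

definition rwalk :: "(nat \<Rightarrow> int \<Rightarrow> nat \<Rightarrow> bool) \<Rightarrow> nat \<Rightarrow> int" where
  "rwalk r n = last (rpath r n)"

lemma rpath_nonempty [simp]: "rpath r n \<noteq> []"
  by (cases n) (auto simp: Let_def)

lemma rpath_eq_map: "rpath r n = map (rwalk r) [0..<Suc n]"
proof (induction n)
  case (Suc n)
  have "rpath r (Suc n) = rpath r n @ [rwalk r (Suc n)]"
    by (simp add: rwalk_def Let_def)
  then show ?case unfolding Suc.IH by simp
qed (simp add: rwalk_def)

lemma length_rpath [simp]: "length (rpath r n) = Suc n"
  by (simp add: rpath_eq_map)

lemma rwalk_0 [simp]: "rwalk r 0 = 0"
  by (simp add: rwalk_def)

lemma rwalk_Suc:
  "rwalk r (Suc n) =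
    (if r n (rwalk r n) (visits (rwalk r) (rwalk r n) (Suc n)) then rwalk r n + 1 else rwalk r n - 1)"
proof -
  have "count_list (rpath r n) (rwalk r n) = visits (rwalk r) (rwalk r n) (Suc n)"
    by (simp add: rpath_eq_map visits_eq_count_list del: upt_Suc)
  then show ?thesis by (simp add: rwalk_def Let_def)
qed

lemma cwalk_eq_rwalk: "cwalk \<omega> u 0 = rwalk (\<lambda>n y k. u n < \<omega> y k)"
proof
  fix n
  have "cpath \<omega> u 0 n = rpath (\<lambda>n y k. u n < \<omega> y k) n" for n
    by (induction n) (simp_all add: Let_def)
  then show "cwalk \<omega> u 0 n = rwalk (\<lambda>n y k. u n < \<omega> y k) n"
    by (simp add: cwalk_def rwalk_def)
qed

definition follows :: "(nat \<Rightarrow> int \<Rightarrow> nat \<Rightarrow> bool) \<Rightarrow> int list \<Rightarrow> nat \<Rightarrow> bool" where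
  "follows r p k \<longleftrightarrow>
     p ! Suc k = (if r k (p ! k) (count_list (take (Suc k) p) (p ! k)) then p ! k + 1 else p ! k - 1)"

text \<open>In \<open>follows\<close> the visit number is computed from the fixed list and not from
  the random walk. The event that the walk runs through \<open>p\<close> thus becomes a finite
  conjunction of conditions on single values of the rule, from which measurability and product
  formulas follow.\<close>

lemma rpath_eq_iff:
  "rpath r n = p \<longleftrightarrow> length p = Suc n \<and> p ! 0 = 0 \<and> (\<forall>k<n. follows r p k)"
proof (induction n arbitrary: p)
  case 0
  show ?case by (cases p) auto
next
  case (Suc n)
  show ?case
  proof (cases p rule: rev_cases)
    case Nil
    then show ?thesis by (simp add: Let_def)
  next
    case (snoc q z)
    show ?thesis
    proof (cases "length q = Suc n")
      case False
      then have "rpath r n \<noteq> q" by (metis length_rpath)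
      with False snoc show ?thesis by (auto simp: Let_def)
    next
      case True
      then have last: "last q = q ! n" by (cases q rule: rev_cases) auto
      have *: "follows r (q @ [z]) k = follows r q k" if "k < n" for k
        using that True by (simp add: follows_def nth_append)
      have 0: "(q @ [z]) ! 0 = q ! 0" using True by (simp add: nth_append)
      have "rpath r (Suc n) = q @ [z] \<longleftrightarrow> rpath r n = q \<and>
          z = (if r n (last q) (count_list q (last q)) then last q + 1 else last q - 1)"
        by (auto simp: Let_def)
      also have "\<dots> \<longleftrightarrow> rpath r n = q \<and> follows r (q @ [z]) n"
        using True last by (simp add: follows_def nth_append)
      also have "\<dots> \<longleftrightarrow> length (q @ [z]) = Suc (Suc n) \<and> (q @ [z]) ! 0 = 0 \<and> (\<forall>k<Suc n. follows r (q @ [z]) k)"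
        using True Suc.IH[of q] * 0 by (auto simp: less_Suc_eq)
      finally show ?thesis using snoc by simp
    qed
  qed
qed

text \<open>Each return to a site raises its visit number. Hence the site-driven walk consults a
  fresh uniform variable at every step.\<close>

lemma inj_visit_label:
  "inj_on (\<lambda>k. (p ! k, count_list (take (Suc k) p) (p ! k))) {..<length p}"
proof (rule linorder_inj_onI)
  fix i j assume ij: "i < j" "i \<in> {..<length p}" "j \<in> {..<length p}"
  show "(p ! i, count_list (take (Suc i) p) (p ! i)) \<noteq> (p ! j, count_list (take (Suc j) p) (p ! j))"
  proof
    assume eq: "(p ! i, count_list (take (Suc i) p) (p ! i)) = (p ! j, count_list (take (Suc j) p) (p ! j))"
    have "take (Suc j) p = take j p @ [p ! j]" using ij by (simp add: take_Suc_conv_app_nth)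
    moreover have "take j p = take (Suc i) p @ drop (Suc i) (take j p)"
      using ij by (metis append_take_drop_id min.absorb1 Suc_leI take_take)
    ultimately have "take (Suc j) p = take (Suc i) p @ drop (Suc i) (take j p) @ [p ! j]" by simp
    then have "count_list (take (Suc j) p) (p ! j) \<ge> Suc (count_list (take (Suc i) p) (p ! j))"
      by simp
    with eq show False by (metis Pair_inject not_less_eq_eq order_refl)
  qed
qed auto

text \<open>The index of the \<open>r\<close>-th success among \<open>s 1, s 2, \<dots>\<close>; a junk value if there are fewer than \<open>r\<close>.\<close>
definition success_index :: "(nat \<Rightarrow> bool) \<Rightarrow> nat \<Rightarrow> nat" where
  "success_index s r = (LEAST v. card {i. 1 \<le> i \<and> i \<le> v \<and> s i} = r)"

lemma success_index_eqI:
  assumes "card {i. 1 \<le> i \<and> i \<le> v \<and> s i} = r" "s v" "1 \<le> v"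
  shows "success_index s r = v"
  unfolding success_index_def
proof (rule Least_equality)
  fix w assume w: "card {i. 1 \<le> i \<and> i \<le> w \<and> s i} = r"
  show "v \<le> w"
  proof (rule ccontr)
    assume "\<not> v \<le> w"
    then have "{i. 1 \<le> i \<and> i \<le> w \<and> s i} \<subseteq> {i. 1 \<le> i \<and> i \<le> v \<and> s i}" by auto
    moreover have "v \<in> {i. 1 \<le> i \<and> i \<le> v \<and> s i} - {i. 1 \<le> i \<and> i \<le> w \<and> s i}"
      using assms(2,3) \<open>\<not> v \<le> w\<close> by simp
    ultimately have "{i. 1 \<le> i \<and> i \<le> w \<and> s i} \<subset> {i. 1 \<le> i \<and> i \<le> v \<and> s i}" by blast
    moreover have "finite {i. 1 \<le> i \<and> i \<le> v \<and> s i}" by simp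
    ultimately have "card {i. 1 \<le> i \<and> i \<le> w \<and> s i} < card {i. 1 \<le> i \<and> i \<le> v \<and> s i}"
      by (intro psubset_card_mono)
    then show False using w assms(1) by simp
  qed
qed (rule assms(1))

text \<open>The number of jumps from \<open>0\<close> to the left before the first visit to \<open>m\<close> of a walk started at
  \<open>0\<close> and steered by the arrows \<open>b\<close>: the walk jumps from \<open>0\<close> to the right once more than
  from \<open>1\<close> to the left, so only the arrows at nonnegative sites matter.\<close>
primrec left_jumps :: "nat \<Rightarrow> (nat \<Rightarrow> nat \<Rightarrow> bool) \<Rightarrow> nat" where
  "left_jumps 0 b = 0"
| "left_jumps (Suc m) b = success_index (b 0) (Suc (left_jumps m (seq_shift b))) - Suc (left_jumps m (seq_shift b))"

text \<open>Before it reaches a positive level the walk leaves \<open>0\<close> for the last time to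
  the right. So the visits to \<open>0\<close> end with the right arrow whose number is one more
  than the number of left jumps from \<open>1\<close>. At level \<open>0\<close> nothing has been
  visited yet.\<close>

definition visits_origin :: "nat \<Rightarrow> (nat \<Rightarrow> nat \<Rightarrow> bool) \<Rightarrow> nat" where
  "visits_origin m b =
     (case m of 0 \<Rightarrow> 0 | Suc m' \<Rightarrow> success_index (b 0) (Suc (left_jumps m' (seq_shift b))))"

lemma visits_origin_0 [simp]: "visits_origin 0 b = 0"
  by (simp add: visits_origin_def)

lemma funpow_seq_shift: "(seq_shift ^^ i) b n = b (n + i)"
  by (induction i arbitrary: n) (simp_all add: seq_shift_def)

text \<open>The time spent at nonnegative sites between the first visits to \<open>m\<close> and to \<open>m + 1\<close>,
  as the sum over the sites \<open>i \<le> m\<close> of the increments of the number of visits.\<close>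
definition added_visits :: "nat \<Rightarrow> (nat \<Rightarrow> nat \<Rightarrow> bool) \<Rightarrow> nat" where
  "added_visits m b =
     (\<Sum>i\<le>m. visits_origin (Suc m - i) ((seq_shift ^^ i) b) - visits_origin (m - i) ((seq_shift ^^ i) b))"

section \<open>Hitting times and occupation times of a path that reaches every level\<close>

locale upward_path =
  fixes y :: "nat \<Rightarrow> int"
  assumes start: "y 0 = 0"
    and step: "y (Suc n) = y n + 1 \<or> y (Suc n) = y n - 1"
    and reach: "\<exists>n. y n = int k"
begin

definition T :: "nat \<Rightarrow> nat" where "T k = (LEAST n. y n = int k)"

lemma y_T [simp]: "y (T k) = int k"
  unfolding T_def using reach by (rule LeastI_ex)

lemma hit_eq: "hit y (int k) = enat (T k)"
  using reach[of k] by (auto simp: hit_def T_def)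

lemma T_le: "y n = int k \<Longrightarrow> T k \<le> n"
  unfolding T_def by (rule Least_le)

lemma intermediate:
  assumes "a \<le> b" "y a \<le> x \<and> x \<le> y b \<or> y b \<le> x \<and> x \<le> y a"
  obtains c where "a \<le> c" "c \<le> b" "y c = x"
proof -
  have st: "\<bar>y (Suc n) - y n\<bar> \<le> 1" for n using step[of n] by auto
  consider "y a \<le> x \<and> x \<le> y b" | "y b \<le> x \<and> x \<le> y a" using assms(2) by blast
  then have "\<exists>c\<ge>a. c \<le> b \<and> y c = x"
  proof cases
    case 1
    then show ?thesis using nat_intermed_int_val[of a b y x] assms(1) st by auto
  next
    case 2
    have "\<bar>- y (Suc n) - (- y n)\<bar> \<le> 1" for n using st[of n] by linarith
    then show ?thesis using nat_intermed_int_val[of a b "\<lambda>n. - y n" "- x"] assms(1) 2 by auto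
  qed
  then show ?thesis using that by blast
qed

lemma below_before_T: "m < T k \<Longrightarrow> y m < int k"
proof (rule ccontr)
  assume m: "m < T k" and "\<not> y m < int k"
  then obtain c where "c \<le> m" "y c = int k"
    using intermediate[of 0 m "int k"] start by auto
  then show False using T_le[of c k] m by simp
qed

lemma T_mono: "k < l \<Longrightarrow> T k < T l"
proof (rule ccontr)
  assume kl: "k < l" and "\<not> T k < T l"
  then have le: "T l \<le> T k" by simp
  then have "T l \<noteq> T k" using kl y_T[of k] y_T[of l] by (metis of_nat_eq_iff nat_neq_iff)
  then have "T l < T k" using le by simp
  then show False using below_before_T[of "T l" k] kl by simp
qed

lemma T_ge: "k \<le> T k"
proof (induction k)
  case (Suc k)
  then show ?case using T_mono[of k "Suc k"] by linarith
qed simp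

lemma displacement: "\<bar>y (n + d) - y n\<bar> \<le> int d"
proof (induction d)
  case (Suc d)
  then show ?case using step[of "n + d"] by auto
qed simp

lemma card_sites_above:
  assumes "finite A"
  shows "card {n \<in> A. y n \<in> {a..<b}} = (\<Sum>x\<in>{a..<b}. card {n \<in> A. y n = x})"
proof -
  have "{n \<in> A. y n \<in> {a..<b}} = (\<Union>x\<in>{a..<b}. {n \<in> A. y n = x})" by auto
  also have "card \<dots> = (\<Sum>x\<in>{a..<b}. card {n \<in> A. y n = x})"
    using assms by (intro card_UN_disjoint) auto
  finally show ?thesis .
qed

lemma visits_T_zero: "int k \<le> x \<Longrightarrow> visits y x (T k) = 0"
  using below_before_T by (fastforce simp: visits_def)

lemma time_decomposition:
  "T k = (\<Sum>x<k. visits y (int x) (T k)) + card {m. m < T k \<and> y m < 0}"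
proof -
  have "{..<T k} = {m \<in> {..<T k}. y m \<in> {0..<int k}} \<union> {m. m < T k \<and> y m < 0}"
    using below_before_T by force
  moreover have "{m \<in> {..<T k}. y m \<in> {0..<int k}} \<inter> {m. m < T k \<and> y m < 0} = {}" by auto
  ultimately have "card {..<T k} = card {m \<in> {..<T k}. y m \<in> {0..<int k}} + card {m. m < T k \<and> y m < 0}"
    by (metis (no_types, lifting) card_Un_disjoint finite_Un finite_lessThan)
  also have "card {m \<in> {..<T k}. y m \<in> {0..<int k}} = (\<Sum>x\<in>{0..<int k}. visits y x (T k))"
    by (subst card_sites_above) (simp_all add: visits_def)
  also have "\<dots> = (\<Sum>x<k. visits y (int x) (T k))"
    by (rule sum.reindex_bij_witness[of _ int nat]) auto
  finally show ?thesis by simp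
qed

text \<open>If \<open>S\<close> contains a time at a site below \<open>k - j\<close>, then on its
  way down from \<open>k\<close> the path has met all \<open>j + 1\<close> sites from
  \<open>k - j\<close> to \<open>k\<close>, so both sides hold; otherwise \<open>S\<close> is the
  window itself. The set \<open>S\<close> is left open because it is needed twice: as all times of
  the waiting period and as those spent at nonnegative sites.\<close>

lemma exceeds_iff:
  assumes jk: "j \<le> k"
    and S: "{n. T k \<le> n \<and> n < T (Suc k) \<and> int (k - j) \<le> y n} \<subseteq> S" "S \<subseteq> {T k..<T (Suc k)}"
  shows "j \<le> card S \<longleftrightarrow> j \<le> card {n. T k \<le> n \<and> n < T (Suc k) \<and> int (k - j) \<le> y n}"
    (is "_ \<longleftrightarrow> j \<le> card ?D")
proof (cases "S = ?D")
  case False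
  with S(1) obtain n where "n \<in> S" "n \<notin> ?D" by blast
  with S(2) have n: "T k \<le> n" "n < T (Suc k)" "y n < int (k - j)" by auto
  have "\<exists>c\<in>?D. y c = x" if x: "x \<in> {int (k - j)..int k}" for x
  proof -
    obtain c where "T k \<le> c" "c \<le> n" "y c = x"
      using intermediate[of "T k" n x] n x by auto
    moreover from this have "c < T (Suc k)" "int (k - j) \<le> y c" using n x by auto
    ultimately show ?thesis by blast
  qed
  then have "{int (k - j)..int k} \<subseteq> y ` ?D" by blast
  then have "card {int (k - j)..int k} \<le> card ?D"
    by (intro surj_card_le) auto
  then have "j \<le> card ?D" using jk by simp
  moreover have "card ?D \<le> card S" by (rule card_mono[OF finite_subset[OF S(2)] S(1)]) simp
  ultimately show ?thesis by linarith
next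
  case True
  then show ?thesis by (rule arg_cong)
qed

lemma card_window:
  assumes "a \<le> k"
  shows "card {n. T k \<le> n \<and> n < T (Suc k) \<and> int a \<le> y n} =
    (\<Sum>x\<in>{a..k}. visits y (int x) (T (Suc k)) - visits y (int x) (T k))"
proof -
  have count: "card {n \<in> {T k..<T (Suc k)}. y n = x} = visits y x (T (Suc k)) - visits y x (T k)" for x
  proof -
    have "{n \<in> {T k..<T (Suc k)}. y n = x} = {m. m < T (Suc k) \<and> y m = x} - {m. m < T k \<and> y m = x}"
      by auto
    moreover have "T k \<le> T (Suc k)" using T_mono[of k "Suc k"] by simp
    moreover from this have "{m. m < T k \<and> y m = x} \<subseteq> {m. m < T (Suc k) \<and> y m = x}" by auto
    then have "card ({m. m < T (Suc k) \<and> y m = x} - {m. m < T k \<and> y m = x}) =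
        card {m. m < T (Suc k) \<and> y m = x} - card {m. m < T k \<and> y m = x}"
      by (intro card_Diff_subset) auto
    ultimately show ?thesis by (simp add: visits_def)
  qed
  have "{n. T k \<le> n \<and> n < T (Suc k) \<and> int a \<le> y n} = {n \<in> {T k..<T (Suc k)}. y n \<in> {int a..<int (Suc k)}}"
    using below_before_T[of _ "Suc k"] by auto
  also have "card \<dots> = (\<Sum>x\<in>{int a..<int (Suc k)}. card {n \<in> {T k..<T (Suc k)}. y n = x})"
    by (rule card_sites_above) simp
  also have "\<dots> = (\<Sum>x\<in>{a..k}. card {n \<in> {T k..<T (Suc k)}. y n = int x})"
    by (rule sum.reindex_bij_witness[of _ int nat]) auto
  finally show ?thesis using count by simp
qed

lemma speed_squeeze:
  assumes n: "T k \<le> n" "n < T (Suc k)"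
  shows "y n \<le> int k" "int k - int (T (Suc k) - T k) \<le> y n"
proof -
  show "y n \<le> int k" using below_before_T[OF n(2)] by simp
  show "int k - int (T (Suc k) - T k) \<le> y n"
    using displacement[of "T k" "n - T k"] n by simp
qed

lemma level_exists: obtains k where "T k \<le> n" "n < T (Suc k)"
proof -
  have "\<exists>k. n < T (Suc k)" using T_ge[of "Suc n"] by (metis Suc_le_lessD)
  then have L: "n < T (Suc (LEAST k. n < T (Suc k)))" by (rule LeastI_ex)
  have "T (LEAST k. n < T (Suc k)) \<le> n"
  proof (cases "LEAST k. n < T (Suc k)")
    case 0
    then show ?thesis using T_le[of 0 0] start by simp
  next
    case (Suc l)
    then have "l < (LEAST k. n < T (Suc k))" by simp
    then have "\<not> n < T (Suc l)" by (rule not_less_Least)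
    then show ?thesis using Suc by simp
  qed
  with L that show ?thesis by blast
qed

end

section \<open>Visit counts as functions of the arrows\<close>

locale steered_path = upward_path +
  fixes a :: "int \<Rightarrow> nat \<Rightarrow> bool"
  assumes steered: "y (Suc n) = y n + 1 \<longleftrightarrow> a (y n) (visits y (y n) (Suc n))"
begin

definition right_moves :: "int \<Rightarrow> nat \<Rightarrow> nat" where
  "right_moves x n = card {m. m < n \<and> y m = x \<and> y (Suc m) = x + 1}"

definition left_moves :: "int \<Rightarrow> nat \<Rightarrow> nat" where
  "left_moves x n = card {m. m < n \<and> y m = x \<and> y (Suc m) = x - 1}"

lemma right_moves_Suc:
  "right_moves x (Suc n) = right_moves x n + (if y n = x \<and> y (Suc n) = x + 1 then 1 else 0)"
  unfolding right_moves_def by (rule card_Suc_filter)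

lemma left_moves_Suc:
  "left_moves x (Suc n) = left_moves x n + (if y n = x \<and> y (Suc n) = x - 1 then 1 else 0)"
  unfolding left_moves_def by (rule card_Suc_filter)

lemma visits_eq_moves: "visits y x n = right_moves x n + left_moves x n"
proof (induction n)
  case (Suc n)
  then show ?case using step[of n] by (auto simp: visits_Suc right_moves_Suc left_moves_Suc)
qed (simp add: right_moves_def left_moves_def)

text \<open>Crossings of the edge from \<open>x\<close> to \<open>x + 1\<close> alternate in
  direction, and the first one goes right because the path starts at \<open>0\<close>.\<close>

lemma crossing_balance:
  assumes "0 \<le> x"
  shows "right_moves x n = left_moves (x + 1) n + (if x < y n then 1 else 0)"
proof (induction n)
  case 0
  then show ?case using assms start by (simp add: right_moves_def left_moves_def)
next
  case (Suc n)
  then show ?case using step[of n] by (auto simp: right_moves_Suc left_moves_Suc)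
qed

lemma right_moves_eq_successes:
  "right_moves x n = card {i. 1 \<le> i \<and> i \<le> visits y x n \<and> a x i}"
proof (induction n)
  case (Suc n)
  show ?case
  proof (cases "y n = x")
    case True
    have "{i. 1 \<le> i \<and> i \<le> Suc (visits y x n) \<and> a x i} =
        {i. 1 \<le> i \<and> i \<le> visits y x n \<and> a x i} \<union> (if a x (Suc (visits y x n)) then {Suc (visits y x n)} else {})"
      by (auto simp: le_Suc_eq)
    then have "card {i. 1 \<le> i \<and> i \<le> Suc (visits y x n) \<and> a x i} =
        card {i. 1 \<le> i \<and> i \<le> visits y x n \<and> a x i} + (if a x (Suc (visits y x n)) then 1 else 0)"
      by auto
    then show ?thesis using Suc True steered[of n]
      by (simp add: right_moves_Suc visits_Suc)
  next
    case False
    then show ?thesis using Suc by (simp add: right_moves_Suc visits_Suc)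
  qed
qed (simp add: right_moves_def)

text \<open>A nearest-neighbour path is above \<open>x\<close> only if its last departure from
  \<open>x\<close> went up.\<close>

lemma last_exit_right:
  assumes "0 \<le> x" "x < y n"
  shows "1 \<le> visits y x n \<and> a x (visits y x n)"
  using assms(2)
proof (induction n)
  case 0
  then show ?case using assms(1) start by simp
next
  case (Suc n)
  consider "y n = x" | "y n > x" | "y n < x" by linarith
  then show ?case
  proof cases
    case 1
    then have "y (Suc n) = y n + 1" using step[of n] Suc.prems by auto
    then show ?thesis using steered[of n] 1 by (simp add: visits_Suc)
  next
    case 2
    then show ?thesis using Suc by (simp add: visits_Suc)
  next
    case 3
    then show ?thesis using Suc.prems step[of n] by auto
  qed
qed

text \<open>The last arrow used at \<open>x\<close> points right, so the number of visits is the
  index of a right arrow; \<open>crossing_balance\<close> tells which one.\<close>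

lemma visits_eq_success_index:
  assumes "0 \<le> x" "x < y n"
  shows "visits y x n = success_index (a x) (Suc (left_moves (x + 1) n))"
proof (rule success_index_eqI[symmetric])
  show "card {i. 1 \<le> i \<and> i \<le> visits y x n \<and> a x i} = Suc (left_moves (x + 1) n)"
    unfolding right_moves_eq_successes[symmetric] crossing_balance[OF assms(1)] using assms(2) by simp
  show "a x (visits y x n)" "1 \<le> visits y x n" using last_exit_right[OF assms] by auto
qed

text \<open>Induction from the level \<open>k\<close> downwards. The left jumps from
  \<open>x + 1\<close>, plus one for the final passage to the right, fix how many right arrows are
  used at \<open>x\<close>; this is a branching process with one immigrant per generation.\<close>

lemma left_moves_T:
  "x + m = k \<Longrightarrow> left_moves (int x) (T k) = left_jumps m (\<lambda>n i. a (int (n + x)) i)"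
proof (induction m arbitrary: x)
  case 0
  then have "visits y (int x) (T k) = 0" by (intro visits_T_zero) simp
  then show ?case unfolding visits_eq_moves by simp
next
  case (Suc m)
  have IH: "left_moves (int (Suc x)) (T k) = left_jumps m (\<lambda>n i. a (int (n + Suc x)) i)"
    using Suc.IH[of "Suc x"] Suc.prems by simp
  have sh: "seq_shift (\<lambda>n i. a (int (n + x)) i) = (\<lambda>n i. a (int (n + Suc x)) i)"
    by (simp add: seq_shift_def add_ac)
  have xk: "int x < y (T k)" using Suc.prems by simp
  have "left_moves (int x) (T k) = visits y (int x) (T k) - right_moves (int x) (T k)"
    by (simp add: visits_eq_moves)
  also have "\<dots> = success_index (a (int x)) (Suc (left_moves (int x + 1) (T k))) - Suc (left_moves (int x + 1) (T k))"
    using visits_eq_success_index[OF _ xk] crossing_balance[of "int x" "T k"] xk by simp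
  also have "int x + 1 = int (Suc x)" by simp
  also note IH
  finally have "left_moves (int x) (T k) =
      success_index (a (int x)) (Suc (left_jumps m (seq_shift (\<lambda>n i. a (int (n + x)) i)))) -
      Suc (left_jumps m (seq_shift (\<lambda>n i. a (int (n + x)) i)))"
    unfolding sh .
  then show ?case by simp
qed

lemma visits_T:
  assumes "x \<le> k"
  shows "visits y (int x) (T k) = visits_origin (k - x) ((seq_shift ^^ x) (\<lambda>n. a (int n)))"
proof (cases "x = k")
  case True
  then show ?thesis using visits_T_zero[of k "int k"] by simp
next
  case False
  then obtain m where m: "k = x + Suc m" using assms less_iff_Suc_add[of x k] by auto
  have sh: "seq_shift ((seq_shift ^^ x) (\<lambda>n. a (int n))) = (\<lambda>n i. a (int (n + Suc x)) i)"
    by (auto simp: seq_shift_def funpow_seq_shift)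
  have "visits y (int x) (T k) = success_index (a (int x)) (Suc (left_moves (int (Suc x)) (T k)))"
    using visits_eq_success_index[of "int x" "T k"] m by (simp add: add.commute)
  also have "left_moves (int (Suc x)) (T k) = left_jumps m (\<lambda>n i. a (int (n + Suc x)) i)"
    using m by (intro left_moves_T) simp
  finally have "visits y (int x) (T k) =
      success_index (a (int x)) (Suc (left_jumps m (seq_shift ((seq_shift ^^ x) (\<lambda>n. a (int n))))))"
    unfolding sh .
  moreover have "(seq_shift ^^ x) (\<lambda>n. a (int n)) 0 = a (int x)" by (simp add: funpow_seq_shift)
  moreover have "k - x = Suc m" using m by simp
  ultimately show ?thesis by (simp add: visits_origin_def)
qed

text \<open>Visits to a site depend only on the arrows at that site and to its right. The time spent
  from \<open>x\<close> on is therefore one fixed function of the arrows as seen from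
  \<open>x\<close>, which makes stationarity applicable.\<close>

lemma card_window_eq:
  assumes "x \<le> k"
  shows "card {n. T k \<le> n \<and> n < T (Suc k) \<and> int x \<le> y n} =
    added_visits (k - x) ((seq_shift ^^ x) (\<lambda>n. a (int n)))"
proof -
  have "card {n. T k \<le> n \<and> n < T (Suc k) \<and> int x \<le> y n} =
      (\<Sum>z\<in>{x..k}. visits_origin (Suc k - z) ((seq_shift ^^ z) (\<lambda>n. a (int n))) -
        visits_origin (k - z) ((seq_shift ^^ z) (\<lambda>n. a (int n))))"
    unfolding card_window[OF assms] by (rule sum.cong) (simp_all add: visits_T)
  also have "\<dots> = added_visits (k - x) ((seq_shift ^^ x) (\<lambda>n. a (int n)))"
    unfolding added_visits_def
  proof (rule sum.reindex_bij_witness[of _ "\<lambda>i. i + x" "\<lambda>z. z - x"])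
    fix z assume z: "z \<in> {x..k}"
    have "(seq_shift ^^ (z - x)) ((seq_shift ^^ x) (\<lambda>n. a (int n))) = (seq_shift ^^ z) (\<lambda>n. a (int n))"
      using z by (simp add: fun_eq_iff funpow_seq_shift)
    moreover have "Suc (k - x) - (z - x) = Suc k - z" "k - x - (z - x) = k - z" using z assms by auto
    ultimately show "visits_origin (Suc (k - x) - (z - x)) ((seq_shift ^^ (z - x)) ((seq_shift ^^ x) (\<lambda>n. a (int n)))) -
        visits_origin (k - x - (z - x)) ((seq_shift ^^ (z - x)) ((seq_shift ^^ x) (\<lambda>n. a (int n)))) =
        visits_origin (Suc k - z) ((seq_shift ^^ z) (\<lambda>n. a (int n))) -
        visits_origin (k - z) ((seq_shift ^^ z) (\<lambda>n. a (int n)))" by simp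
  qed (use assms in auto)
  finally show ?thesis .
qed

end

section \<open>An ergodic theorem\<close>

locale ergodic_map = prob_space M for M :: "'a measure" +
  fixes \<tau> :: "'a \<Rightarrow> 'a"
  assumes meas [measurable]: "\<tau> \<in> measurable M M"
    and preserving: "distr M M \<tau> = M"
    and ergodic: "\<And>A. A \<in> sets M \<Longrightarrow> \<tau> -` A \<inter> space M = A \<Longrightarrow> prob A \<in> {0, 1}"
begin

lemma funpow_measurable [measurable]: "\<tau> ^^ i \<in> measurable M M"
  by (induction i) (simp_all add: id_def comp_def)

lemma distr_funpow: "distr M M (\<tau> ^^ i) = M"
proof (induction i)
  case (Suc i)
  have "distr M M (\<tau> ^^ Suc i) = distr (distr M M (\<tau> ^^ i)) M \<tau>"
    by (subst distr_distr) (simp_all add: comp_def)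
  then show ?case unfolding Suc.IH preserving .
qed (simp add: id_def distr_id)

lemma AE_funpow:
  assumes "AE x in M. P x"
  shows "AE x in M. \<forall>i. P ((\<tau> ^^ i) x)"
proof -
  have "AE x in M. P ((\<tau> ^^ i) x)" for i
    by (rule AE_distrD[OF funpow_measurable]) (use assms in \<open>subst distr_funpow\<close>)
  then show ?thesis by (simp add: AE_all_countable)
qed

lemma nn_integral_funpow:
  "f \<in> borel_measurable M \<Longrightarrow> (\<integral>\<^sup>+x. f ((\<tau> ^^ i) x) \<partial>M) = (\<integral>\<^sup>+x. f x \<partial>M)"
  by (subst (2) distr_funpow[of i, symmetric], subst nn_integral_distr) auto

lemma emeasure_funpow:
  assumes "Measurable.pred M P"
  shows "emeasure M {x \<in> space M. P ((\<tau> ^^ i) x)} = emeasure M {x \<in> space M. P x}"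
proof -
  have "emeasure M {x \<in> space M. P x} = emeasure (distr M M (\<tau> ^^ i)) {x \<in> space M. P x}"
    by (simp add: distr_funpow)
  also have "\<dots> = emeasure M ((\<tau> ^^ i) -` {x \<in> space M. P x} \<inter> space M)"
    using assms by (intro emeasure_distr) auto
  also have "(\<tau> ^^ i) -` {x \<in> space M. P x} \<inter> space M = {x \<in> space M. P ((\<tau> ^^ i) x)}"
    using measurable_space[OF funpow_measurable[of i]] by auto
  finally show ?thesis by simp
qed

section \<open>Birkhoff sums and the maximal inequality\<close>

definition birkhoff_sum :: "('a \<Rightarrow> real) \<Rightarrow> nat \<Rightarrow> 'a \<Rightarrow> real" where
  "birkhoff_sum g n x = (\<Sum>i<n. g ((\<tau> ^^ i) x))"

lemma birkhoff_sum_Suc: "birkhoff_sum g (Suc n) x = g x + birkhoff_sum g n (\<tau> x)"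
  unfolding birkhoff_sum_def sum.lessThan_Suc_shift by (simp add: funpow_swap1)

text \<open>The maximum of the first \<open>n + 1\<close> Birkhoff sums, including the empty sum.\<close>
primrec max_sum :: "('a \<Rightarrow> real) \<Rightarrow> nat \<Rightarrow> 'a \<Rightarrow> real" where
  "max_sum g 0 x = 0"
| "max_sum g (Suc n) x = max 0 (g x + max_sum g n (\<tau> x))"

lemma max_sum_nonneg: "0 \<le> max_sum g n x"
  by (cases n) simp_all

lemma max_sum_le_Suc: "max_sum g n x \<le> max_sum g (Suc n) x"
proof (induction n arbitrary: x)
  case (Suc n)
  have "max 0 (g x + max_sum g n (\<tau> x)) \<le> max 0 (g x + max_sum g (Suc n) (\<tau> x))"
    using Suc[of "\<tau> x"] by linarith
  then show ?case by (simp only: max_sum.simps)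
qed simp

lemma max_sum_mono: "m \<le> n \<Longrightarrow> max_sum g m x \<le> max_sum g n x"
  using max_sum_le_Suc by (rule lift_Suc_mono_le)

lemma birkhoff_sum_le_max_sum: "birkhoff_sum g n x \<le> max_sum g n x"
proof (induction n arbitrary: x)
  case (Suc n)
  show ?case using Suc[of "\<tau> x"] by (simp add: birkhoff_sum_Suc)
qed (simp add: birkhoff_sum_def)

lemma integrable_comp:
  fixes f :: "'a \<Rightarrow> real"
  assumes "integrable M f"
  shows "integrable M (\<lambda>x. f (\<tau> x))"
proof -
  have "integrable (distr M M \<tau>) f" using assms by (simp add: preserving)
  then show ?thesis by (rule integrable_distr[OF meas])
qed

lemma expectation_comp:
  fixes f :: "'a \<Rightarrow> real"
  assumes "integrable M f"
  shows "expectation (\<lambda>x. f (\<tau> x)) = expectation f"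
  using integral_distr[OF meas, of f] assms by (simp add: preserving)

lemma integrable_max_sum:
  assumes "integrable M g"
  shows "integrable M (max_sum g n)"
proof (induction n)
  case 0
  show ?case by simp
next
  case (Suc n)
  have "integrable M (\<lambda>x. max 0 (g x + max_sum g n (\<tau> x)))"
    using assms integrable_comp[OF Suc] by (intro integrable_max) auto
  then show ?case by (simp add: fun_eq_iff cong: integrable_cong)
qed

text \<open>Garsia's argument: the difference of the maximal sum at \<open>x\<close> and at
  \<open>\<tau> x\<close> has mean zero, is at most \<open>g x\<close> where the maximal sum is
  positive, and is at most \<open>0\<close> elsewhere.\<close>

lemma maximal_inequality:
  assumes g: "integrable M g"
  shows "0 \<le> expectation (\<lambda>x. g x * indicator {x \<in> space M. 0 < max_sum g (Suc n) x} x)"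
proof -
  note [measurable] = borel_measurable_integrable[OF g] borel_measurable_integrable[OF integrable_max_sum[OF g, of "Suc n"]]
  let ?m = "max_sum g (Suc n)"
  have "0 = expectation (\<lambda>x. ?m x - ?m (\<tau> x))"
    using expectation_comp[OF integrable_max_sum[OF g, of "Suc n"]]
    by (subst Bochner_Integration.integral_diff)
      (auto simp del: max_sum.simps intro!: integrable_comp integrable_max_sum g)
  also have "\<dots> \<le> expectation (\<lambda>x. g x * indicator {x \<in> space M. 0 < ?m x} x)"
  proof (rule integral_mono)
    show "integrable M (\<lambda>x. ?m x - ?m (\<tau> x))"
      by (intro Bochner_Integration.integrable_diff integrable_comp integrable_max_sum g)
    show "integrable M (\<lambda>x. g x * indicator {x \<in> space M. 0 < ?m x} x)"
    proof (rule integrable_real_mult_indicator[OF _ g])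
      have "Measurable.pred M (\<lambda>x. 0 < ?m x)" by measurable
      then show "{x \<in> space M. 0 < ?m x} \<in> sets M" by simp
    qed
    fix x assume x: "x \<in> space M"
    show "?m x - ?m (\<tau> x) \<le> g x * indicator {x \<in> space M. 0 < ?m x} x"
    proof (cases "0 < ?m x")
      case True
      then have "?m x = g x + max_sum g n (\<tau> x)" by (auto simp: max_def split: if_splits)
      moreover have "max_sum g n (\<tau> x) \<le> ?m (\<tau> x)" by (rule max_sum_le_Suc)
      ultimately show ?thesis using True x by (simp del: max_sum.simps)
    next
      case False
      then show ?thesis using max_sum_nonneg[of g "Suc n" "\<tau> x"] by (simp del: max_sum.simps)
    qed
  qed
  finally show ?thesis .
qed

text \<open>Unboundedness is an invariant event, so it has probability 0 or 1. If it had probability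
  1, the indicators in the maximal inequality would tend to 1 almost surely, and the limit would
  give a nonnegative mean.\<close>

lemma birkhoff_sum_bounded_above:
  assumes g: "integrable M g" and neg: "expectation g < 0"
  shows "AE x in M. \<exists>c. \<forall>n. birkhoff_sum g n x \<le> c"
proof -
  note [measurable] = borel_measurable_integrable[OF g]
  have [measurable]: "birkhoff_sum g n \<in> borel_measurable M" for n
    unfolding birkhoff_sum_def by measurable
  define A where "A = {x \<in> space M. \<forall>c::nat. \<exists>n. real c < birkhoff_sum g n x}"
  have A [measurable]: "A \<in> sets M" unfolding A_def by measurable
  \<comment> \<open>The sums started at \<open>x\<close> and at \<open>\<tau> x\<close> differ by
    the single term \<open>g x\<close>, which does not affect unboundedness.\<close>
  have Suc_iff: "(\<forall>c::nat. \<exists>n. real c < birkhoff_sum g n x) \<longleftrightarrow> (\<forall>c::nat. \<exists>n. real c < birkhoff_sum g n (\<tau> x))" for x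
  proof safe
    fix c assume *: "\<forall>c::nat. \<exists>n. real c < birkhoff_sum g n x"
    obtain d :: nat where d: "g x + real c \<le> real d" using real_arch_simple by blast
    obtain n where n: "real d < birkhoff_sum g n x" using * by blast
    then have "n \<noteq> 0" by (auto simp: birkhoff_sum_def intro: ccontr)
    then obtain m where "n = Suc m" by (cases n) auto
    then show "\<exists>n. real c < birkhoff_sum g n (\<tau> x)" using n d
      by (intro exI[of _ m]) (simp add: birkhoff_sum_Suc)
  next
    fix c assume *: "\<forall>c::nat. \<exists>n. real c < birkhoff_sum g n (\<tau> x)"
    obtain d :: nat where d: "real c - g x \<le> real d" using real_arch_simple by blast
    obtain n where n: "real d < birkhoff_sum g n (\<tau> x)" using * by blast
    then show "\<exists>n. real c < birkhoff_sum g n x" using d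
      by (intro exI[of _ "Suc n"]) (simp add: birkhoff_sum_Suc)
  qed
  have "\<tau> -` A \<inter> space M = A"
    using measurable_space[OF meas] Suc_iff unfolding A_def by blast
  then have "prob A \<in> {0, 1}" by (rule ergodic[OF A])
  moreover have "prob A \<noteq> 1"
  proof
    assume "prob A = 1"
    then have AE: "AE x in M. x \<in> A" using A by (simp add: prob_eq_1)
    have lim: "AE x in M. (\<lambda>n. g x * indicator {x \<in> space M. 0 < max_sum g (Suc n) x} x) \<longlonglongrightarrow> g x"
      using AE
    proof (eventually_elim)
      case (elim x)
      then have "\<exists>n. real 0 < birkhoff_sum g n x" unfolding A_def by blast
      then obtain n where "0 < birkhoff_sum g n x" by auto
      then have "0 < max_sum g n x" using birkhoff_sum_le_max_sum[of g n x] by linarith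
      then have pos: "0 < max_sum g (Suc m) x" if "m \<ge> n" for m
        using max_sum_mono[of n "Suc m" g x] that by linarith
      show ?case
        by (rule tendsto_eventually, rule eventually_sequentiallyI[of n])
          (use elim pos in \<open>simp add: A_def del: max_sum.simps\<close>)
    qed
    have [measurable]: "max_sum g n \<in> borel_measurable M" for n
      using integrable_max_sum[OF g] by auto
    have "(\<lambda>n. expectation (\<lambda>x. g x * indicator {x \<in> space M. 0 < max_sum g (Suc n) x} x)) \<longlonglongrightarrow> expectation g"
    proof (rule integral_dominated_convergence[where w = "\<lambda>x. \<bar>g x\<bar>"])
      show "AE x in M. norm (g x * indicator {x \<in> space M. 0 < max_sum g (Suc n) x} x) \<le> \<bar>g x\<bar>" for n
        by (auto simp: indicator_def)
      show "(\<lambda>x. g x * indicator {x \<in> space M. 0 < max_sum g (Suc n) x} x) \<in> borel_measurable M" for n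
        by measurable
    qed (use g lim in auto)
    then have "0 \<le> expectation g"
      by (rule LIMSEQ_le_const) (use maximal_inequality[OF g] in blast)
    then show False using neg by simp
  qed
  ultimately have "prob A = 0" by simp
  then have "AE x in M. x \<notin> A" using A by (simp add: prob_eq_0)
  then show ?thesis using AE_space
  proof eventually_elim
    case (elim x)
    then show ?case unfolding A_def by (auto simp: not_less)
  qed
qed

text \<open>One-sided form of the ergodic theorem; the lower bound is obtained by applying it to the
  negated function.\<close>

lemma birkhoff_upper:
  assumes f: "integrable M f" and "0 < e"
  shows "AE x in M. eventually (\<lambda>n. birkhoff_sum f n x \<le> real n * (expectation f + e)) sequentially"
proof -
  \<comment> \<open>Half of \<open>e\<close> makes the mean of \<open>g\<close> negative; the other
    half absorbs the resulting bound \<open>c\<close> once \<open>n\<close> is large.\<close>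
  define g where "g x = f x - (expectation f + e / 2)" for x
  have "expectation g = - e / 2" unfolding g_def using f by (simp add: prob_space)
  then have "AE x in M. \<exists>c. \<forall>n. birkhoff_sum g n x \<le> c"
    using assms by (intro birkhoff_sum_bounded_above) (auto simp: g_def[abs_def])
  then show ?thesis
  proof eventually_elim
    case (elim x)
    then obtain c where c: "\<And>n. birkhoff_sum g n x \<le> c" by blast
    obtain N :: nat where N: "2 * c / e \<le> real N" using real_arch_simple by blast
    show ?case
    proof (rule eventually_sequentiallyI)
      fix n assume "N \<le> n"
      then have "2 * c / e \<le> real n" using N by simp
      then have "c \<le> real n * (e / 2)" using \<open>0 < e\<close> by (simp add: field_simps)
      moreover have "birkhoff_sum f n x = birkhoff_sum g n x + real n * (expectation f + e / 2)"
        unfolding birkhoff_sum_def g_def by (simp add: sum_subtractf)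
      ultimately show "birkhoff_sum f n x \<le> real n * (expectation f + e)"
        using c[of n] by (simp add: algebra_simps)
    qed
  qed
qed

end

section \<open>Ergodicity of i.i.d. sequences and of their products with ergodic sequences\<close>

lemma restrict_UNIV: "restrict f UNIV = f"
  by (simp add: restrict_def)

lemma measurable_seq_shift [measurable]:
  "seq_shift \<in> measurable (PiM UNIV (\<lambda>_::nat. N)) (PiM UNIV (\<lambda>_::nat. N))"
  unfolding seq_shift_def by (rule measurable_PiM_single') (auto simp: space_PiM)

lemma measurable_funpow_seq_shift [measurable]:
  "seq_shift ^^ n \<in> measurable (PiM UNIV (\<lambda>_::nat. N)) (PiM UNIV (\<lambda>_::nat. N))"
  by (induction n) (simp_all add: id_def comp_def)

text \<open>Kolmogorov's 0-1 law, with dependence on the coordinates from \<open>n\<close> on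
  expressed by a preimage under the shift. The set \<open>C\<close> may vary with \<open>n\<close>,
  as it does for sections of an invariant set of a product.\<close>

lemma tail_event_prob:
  fixes N :: "'a measure"
  assumes N: "prob_space N"
    and B: "\<And>n. \<exists>C \<in> sets (PiM UNIV (\<lambda>_::nat. N)). B = (seq_shift ^^ n) -` C \<inter> space (PiM UNIV (\<lambda>_::nat. N))"
  shows "measure (PiM UNIV (\<lambda>_::nat. N)) B \<in> {0, 1}"
proof -
  interpret N: prob_space N by fact
  interpret product_prob_space "\<lambda>_::nat. N" UNIV by unfold_locales
  let ?S = "PiM UNIV (\<lambda>_::nat. N)"
  \<comment> \<open>The sigma-algebra generated by the coordinate \<open>i\<close>.\<close>
  define A where "A i = {(\<lambda>w. w i) -` C \<inter> space ?S | C. C \<in> sets N}" for i :: nat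
  have space_S: "(\<lambda>w. w i) \<in> space ?S \<rightarrow> space N" for i :: nat
    by (auto simp: space_PiM)
  have sigA: "sigma_algebra (space ?S) (A i)" for i
    using sets.sigma_algebra_axioms[of "vimage_algebra (space ?S) (\<lambda>w. w i) N"]
    by (simp add: sets_vimage_algebra2[OF space_S] A_def)
  have "P.indep_vars (\<lambda>_. N) (\<lambda>i w. w i) UNIV"
  proof (subst P.indep_vars_iff_distr_eq_PiM)
    show "distr ?S ?S (\<lambda>x. \<lambda>i\<in>UNIV. x i) = (\<Pi>\<^sub>M i\<in>UNIV. distr ?S N (\<lambda>w. w i))"
      by (simp add: PiM_component distr_id restrict_UNIV)
  qed auto
  then have indep: "P.indep_sets A UNIV"
    unfolding A_def[abs_def] by (simp add: P.indep_vars_def2)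
  have "B \<in> sigma_sets (space ?S) (\<Union> (A ` {n..}))" for n
  proof -
    obtain C where C: "C \<in> sets ?S" "B = (seq_shift ^^ n) -` C \<inter> space ?S" using B by blast
    let ?V = "sigma (space ?S) (\<Union> (A ` {n..}))"
    have sub: "\<Union> (A ` {n..}) \<subseteq> Pow (space ?S)" by (auto simp: A_def)
    have "(seq_shift ^^ n) \<in> measurable ?V ?S"
    proof (rule measurable_PiM_single)
      show "seq_shift ^^ n \<in> space ?V \<rightarrow> (\<Pi>\<^sub>E i\<in>UNIV. space N)"
        using sub by (auto simp: space_measure_of_conv space_PiM PiE_iff funpow_seq_shift)
      fix E and i :: nat assume E: "E \<in> sets N"
      have "{\<omega> \<in> space ?V. (seq_shift ^^ n) \<omega> i \<in> E} = (\<lambda>w. w (i + n)) -` E \<inter> space ?S"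
        using sub by (auto simp: space_measure_of_conv funpow_seq_shift)
      also have "\<dots> \<in> A (i + n)" using E by (auto simp: A_def)
      finally show "{\<omega> \<in> space ?V. (seq_shift ^^ n) \<omega> i \<in> E} \<in> sets ?V"
        using sub by (auto intro!: sigma_sets.Basic bexI[of _ "i + n"])
    qed
    then have "(seq_shift ^^ n) -` C \<inter> space ?V \<in> sets ?V" by (rule measurable_sets[OF _ C(1)])
    then show ?thesis using sub C(2) by (simp add: space_measure_of_conv)
  qed
  then have "B \<in> P.tail_events A" by (simp add: P.tail_events_def)
  then show ?thesis using P.kolmogorov_0_1_law[OF sigA indep] by auto
qed

lemma funpow_vimage_invariant:
  assumes "\<tau> -` B \<inter> S = B" "\<tau> \<in> S \<rightarrow> S"
  shows "(\<tau> ^^ n) -` B \<inter> S = B"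
proof (induction n)
  case (Suc n)
  have "(\<tau> ^^ Suc n) -` B \<inter> S = \<tau> -` ((\<tau> ^^ n) -` B \<inter> S) \<inter> S"
    using assms(2) by (auto simp: funpow_swap1)
  then show ?case unfolding Suc.IH assms(1) .
qed (use assms(1) in auto)

lemma distr_seq_shift_PiM:
  assumes "prob_space N"
  shows "distr (PiM UNIV (\<lambda>_::nat. N)) (PiM UNIV (\<lambda>_::nat. N)) seq_shift = PiM UNIV (\<lambda>_::nat. N)"
  using distr_PiM_reindex[of UNIV "\<lambda>_::nat. N" Suc UNIV] assms
  by (simp add: seq_shift_def[abs_def] restrict_UNIV)

lemma ergodic_map_iid:
  assumes N: "prob_space N"
  shows "ergodic_map (PiM UNIV (\<lambda>_::nat. N)) seq_shift"
proof -
  let ?S = "PiM UNIV (\<lambda>_::nat. N)"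
  interpret S: prob_space ?S by (rule prob_space_PiM) (rule N)
  show ?thesis
  proof
    fix A assume A: "A \<in> sets ?S" "seq_shift -` A \<inter> space ?S = A"
    have "A = (seq_shift ^^ n) -` A \<inter> space ?S" for n
      using funpow_vimage_invariant[OF A(2) measurable_seq_shift[THEN measurable_space, THEN funcsetI]] by simp
    then show "S.prob A \<in> {0, 1}" using A(1) by (intro tail_event_prob[OF N]) blast
  qed (simp_all add: distr_seq_shift_PiM[OF N])
qed

text \<open>For fixed first component the section of an invariant event is a tail event
  of the i.i.d. component, so its probability is an invariant function with values in \<open>{0, 1}\<close>.\<close>
lemma ergodic_map_times_iid:
  fixes R :: "(nat \<Rightarrow> 'b) measure" and N :: "'a measure"
  assumes R: "ergodic_map R seq_shift" and N: "prob_space N"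
  shows "ergodic_map (R \<Otimes>\<^sub>M PiM UNIV (\<lambda>_::nat. N)) (map_prod seq_shift seq_shift)"
proof -
  let ?S = "PiM UNIV (\<lambda>_::nat. N)"
  interpret R: ergodic_map R seq_shift by fact
  interpret S: prob_space ?S by (rule prob_space_PiM) (rule N)
  interpret RS: pair_prob_space R ?S ..
  have mp: "map_prod f g = (\<lambda>(x, y). (f x, g y))" for f :: "(nat \<Rightarrow> 'b) \<Rightarrow> (nat \<Rightarrow> 'b)" and g :: "(nat \<Rightarrow> 'a) \<Rightarrow> (nat \<Rightarrow> 'a)"
    by auto
  have meas [measurable]: "map_prod seq_shift seq_shift \<in> measurable (R \<Otimes>\<^sub>M ?S) (R \<Otimes>\<^sub>M ?S)"
    unfolding mp by measurable
  show ?thesis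
  proof
    show "map_prod seq_shift seq_shift \<in> measurable (R \<Otimes>\<^sub>M ?S) (R \<Otimes>\<^sub>M ?S)" by (rule meas)
    show "distr (R \<Otimes>\<^sub>M ?S) (R \<Otimes>\<^sub>M ?S) (map_prod seq_shift seq_shift) = R \<Otimes>\<^sub>M ?S"
      unfolding mp using pair_measure_distr[of seq_shift R R seq_shift ?S ?S]
      by (simp add: R.preserving distr_seq_shift_PiM[OF N] S.sigma_finite_measure_axioms)
    fix A assume A [measurable]: "A \<in> sets (R \<Otimes>\<^sub>M ?S)"
      and inv: "map_prod seq_shift seq_shift -` A \<inter> space (R \<Otimes>\<^sub>M ?S) = A"
    define g where "g w = emeasure ?S (Pair w -` A)" for w
    have g [measurable]: "g \<in> borel_measurable R"
      unfolding g_def using A by (rule S.measurable_emeasure_Pair)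
    have invn: "(map_prod seq_shift seq_shift ^^ n) -` A \<inter> space (R \<Otimes>\<^sub>M ?S) = A" for n
      using measurable_space[OF meas] by (intro funpow_vimage_invariant[OF inv]) auto
    have mpn: "(map_prod seq_shift seq_shift ^^ n) = map_prod (seq_shift ^^ n) (seq_shift ^^ n)" for n
      by (induction n) (auto simp: fun_eq_iff)
    have sect: "Pair w -` A = (seq_shift ^^ n) -` (Pair ((seq_shift ^^ n) w) -` A) \<inter> space ?S"
      if w: "w \<in> space R" for w n
    proof -
      have "(w, b) \<in> A \<longleftrightarrow> ((seq_shift ^^ n) w, (seq_shift ^^ n) b) \<in> A \<and> b \<in> space ?S" for b
        using arg_cong[OF invn[of n], of "\<lambda>B. (w, b) \<in> B"] w
        by (simp add: mpn space_pair_measure conj_commute)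
      then show ?thesis by auto
    qed
    have g01: "g w \<in> {0, 1}" if w: "w \<in> space R" for w
    proof -
      have "measure ?S (Pair w -` A) \<in> {0, 1}"
        by (rule tail_event_prob[OF N], rule bexI, rule sect[OF w], rule sets_Pair1[OF A])
      then show ?thesis unfolding g_def S.emeasure_eq_measure by auto
    qed
    have ginv: "g (seq_shift w) = g w" if w: "w \<in> space R" for w
    proof -
      have "g w = emeasure ?S (seq_shift -` (Pair (seq_shift w) -` A) \<inter> space ?S)"
        unfolding g_def using sect[OF w, of 1] by simp
      also have "\<dots> = emeasure (distr ?S ?S seq_shift) (Pair (seq_shift w) -` A)"
        using A by (intro emeasure_distr[symmetric]) (auto intro: sets_Pair1)
      finally show ?thesis by (simp add: distr_seq_shift_PiM[OF N] g_def)
    qed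
    define G where "G = {w \<in> space R. g w = 1}"
    have G [measurable]: "G \<in> sets R" unfolding G_def by measurable
    have "seq_shift -` G \<inter> space R = G"
      using ginv measurable_space[OF R.meas] by (auto simp: G_def)
    then have G01: "R.prob G \<in> {0, 1}" by (rule R.ergodic[OF G])
    have "emeasure (R \<Otimes>\<^sub>M ?S) A = (\<integral>\<^sup>+w. g w \<partial>R)"
      unfolding g_def using A by (rule S.emeasure_pair_measure_alt)
    also have "\<dots> = (\<integral>\<^sup>+w. indicator G w \<partial>R)"
      using g01 by (intro nn_integral_cong) (auto simp: G_def indicator_def)
    also have "\<dots> = emeasure R G" by simp
    finally have "RS.prob A = R.prob G" by (simp add: measure_def)
    then show "RS.prob A \<in> {0, 1}" using G01 by simp
  qed
qed

section \<open>Time-driven and site-driven walks\<close>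

abbreviation unif :: "real measure" where "unif \<equiv> uniform_measure lborel {0..1}"

lemma prob_space_unif: "prob_space unif"
  by (rule prob_space_uniform_measure) auto

definition site_unif :: "env measure" where
  "site_unif = Pi\<^sub>M UNIV (\<lambda>_::int. Pi\<^sub>M UNIV (\<lambda>_::nat. unif))"

definition arrows :: "env \<times> env \<Rightarrow> int \<Rightarrow> nat \<Rightarrow> bool" where
  "arrows \<xi> y k \<longleftrightarrow> snd \<xi> y k < fst \<xi> y k"

definition site_walk :: "env \<times> env \<Rightarrow> nat \<Rightarrow> int" where
  "site_walk \<xi> = rwalk (\<lambda>_. arrows \<xi>)"

definition path_space :: "(nat \<Rightarrow> int) measure" where
  "path_space = Pi\<^sub>M UNIV (\<lambda>_::nat. count_space UNIV)"

lemma space_env [simp]: "space env_space = UNIV"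
  by (simp add: env_space_def space_PiM)

lemma measurable_env_coord [measurable (raw)]:
  assumes "f \<in> measurable M env_space"
  shows "(\<lambda>x. f x y k) \<in> borel_measurable M"
proof -
  have 1: "(\<lambda>w. w y) \<in> measurable env_space (Pi\<^sub>M UNIV (\<lambda>_::nat. borel))"
    unfolding env_space_def by measurable
  have 2: "(\<lambda>f. f k) \<in> measurable (Pi\<^sub>M UNIV (\<lambda>_::nat. borel :: real measure)) borel" by measurable
  have "(\<lambda>w. w y k) \<in> borel_measurable env_space" using measurable_compose[OF 1 2] .
  from measurable_compose[OF assms this] show ?thesis .
qed

lemma sets_site_unif [measurable_cong]: "sets site_unif = sets env_space"
  unfolding site_unif_def env_space_def by (intro sets_PiM_cong) simp_all

lemma prob_space_unif_seq: "prob_space unif_seq"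
  unfolding unif_seq_def by (intro prob_space_PiM prob_space_unif)

lemma prob_space_site_unif: "prob_space site_unif"
  unfolding site_unif_def by (intro prob_space_PiM prob_space_unif)

lemma measurable_unif_seq_coord [measurable (raw)]:
  assumes "f \<in> measurable M unif_seq"
  shows "(\<lambda>x. f x k) \<in> borel_measurable M"
proof -
  have "(\<lambda>w. w k) \<in> measurable unif_seq unif" unfolding unif_seq_def by measurable
  then have "(\<lambda>w. w k) \<in> borel_measurable unif_seq" by (simp cong: measurable_cong_sets)
  from measurable_compose[OF assms this] show ?thesis .
qed

section \<open>Path probabilities under both drivings\<close>

lemma emeasure_PiM_inj:
  assumes N: "prob_space N" and inj: "inj_on e K" and K: "finite K"
    and C: "\<And>k. k \<in> K \<Longrightarrow> C k \<in> sets N"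
  shows "emeasure (PiM UNIV (\<lambda>_. N)) {w \<in> space (PiM UNIV (\<lambda>_. N)). \<forall>k\<in>K. w (e k) \<in> C k} =
    (\<Prod>k\<in>K. emeasure N (C k))"
proof -
  interpret N: prob_space N by fact
  interpret product_prob_space "\<lambda>_. N" UNIV by unfold_locales
  let ?C = "\<lambda>i. C (inv_into K e i)"
  have "{w \<in> space (PiM UNIV (\<lambda>_. N)). \<forall>k\<in>K. w (e k) \<in> C k} =
      {w \<in> space (PiM UNIV (\<lambda>_. N)). \<forall>i\<in>e ` K. w i \<in> ?C i}"
    using inj by (auto simp: inv_into_f_f)
  also have "emeasure (PiM UNIV (\<lambda>_. N)) \<dots> = (\<Prod>i\<in>e ` K. emeasure N (?C i))"
    using C K inj by (intro emeasure_PiM_Collect) (auto simp: inv_into_f_f)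
  also have "\<dots> = (\<Prod>k\<in>K. emeasure N (C k))"
    using inj by (subst prod.reindex) (auto simp: inv_into_f_f intro!: prod.cong)
  finally show ?thesis .
qed

text \<open>Since \<open>site_unif\<close> is a product of products, the conditions are grouped by
  site; the product formula is applied first over the sites and then over the visits to each of
  them.\<close>

lemma emeasure_site_unif_inj:
  assumes inj: "inj_on e K" and K: "finite K" and C: "\<And>k. k \<in> K \<Longrightarrow> C k \<in> sets unif"
  shows "emeasure site_unif {U \<in> space site_unif. \<forall>k\<in>K. U (fst (e k)) (snd (e k)) \<in> C k} =
    (\<Prod>k\<in>K. emeasure unif (C k))"
proof -
  let ?Q = "Pi\<^sub>M UNIV (\<lambda>_::nat. unif)"
  interpret Q: prob_space ?Q by (intro prob_space_PiM prob_space_unif)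
  interpret product_prob_space "\<lambda>_::int. ?Q" UNIV by unfold_locales
  let ?K = "\<lambda>x. {k \<in> K. fst (e k) = x}"
  let ?X = "\<lambda>x. {f \<in> space ?Q. \<forall>k\<in>?K x. f (snd (e k)) \<in> C k}"
  have X: "?X x \<in> sets ?Q" for x
  proof -
    have "{f \<in> space ?Q. f (snd (e k)) \<in> C k} \<in> sets ?Q" if "k \<in> K" for k
      using C[OF that] by (rule sets_Collect_single[OF UNIV_I])
    then show ?thesis using K by (intro sets.sets_Collect_finite_All) auto
  qed
  have "{U \<in> space site_unif. \<forall>k\<in>K. U (fst (e k)) (snd (e k)) \<in> C k} =
      {U \<in> space (Pi\<^sub>M UNIV (\<lambda>_::int. ?Q)). \<forall>x\<in>fst ` e ` K. U x \<in> ?X x}"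
    by (auto simp: site_unif_def space_PiM)
  also have "emeasure site_unif \<dots> = (\<Prod>x\<in>fst ` e ` K. emeasure ?Q (?X x))"
    unfolding site_unif_def using K X by (intro emeasure_PiM_Collect) auto
  also have "\<dots> = (\<Prod>x\<in>fst ` e ` K. \<Prod>k\<in>?K x. emeasure unif (C k))"
  proof (rule prod.cong[OF refl])
    fix x
    have "inj_on (\<lambda>k. snd (e k)) (?K x)"
      using inj by (auto simp: inj_on_def prod_eq_iff)
    then show "emeasure ?Q (?X x) = (\<Prod>k\<in>?K x. emeasure unif (C k))"
      using K C by (intro emeasure_PiM_inj prob_space_unif) auto
  qed
  also have "\<dots> = (\<Prod>k\<in>K. emeasure unif (C k))"
    using K by (intro prod.group) auto
  finally show ?thesis .
qed

text \<open>For a fixed list, step \<open>k\<close> restricts its uniform variable to the same set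
  \<open>C k\<close> in both drivings. Only the label of that variable differs, \<open>k\<close> or
  \<open>e k\<close>, and both labellings are injective, so both sides are the same product.\<close>

lemma path_law_quenched:
  "emeasure unif_seq {u \<in> space unif_seq. rpath (\<lambda>n y k. u n < \<omega> y k) n = p} =
   emeasure site_unif {U \<in> space site_unif. rpath (\<lambda>_. arrows (\<omega>, U)) n = p}"
proof (cases "length p = Suc n \<and> p ! 0 = 0")
  case False
  then show ?thesis by (auto simp: rpath_eq_iff)
next
  case True
  define e where "e k = (p ! k, count_list (take (Suc k) p) (p ! k))" for k
  \<comment> \<open>The values of the uniform that lead from the \<open>k\<close>-th to the next
    entry of \<open>p\<close>; the set is empty if these are not neighbours.\<close>
  define C where "C k = {z::real. p ! Suc k = (if z < \<omega> (fst (e k)) (snd (e k)) then p ! k + 1 else p ! k - 1)}" for k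
  have C: "C k \<in> sets unif" for k unfolding C_def by simp
  have inj: "inj_on e {..<n}"
    using inj_on_subset[OF inj_visit_label[of p]] True unfolding e_def by auto
  have "{u \<in> space unif_seq. rpath (\<lambda>n y k. u n < \<omega> y k) n = p} =
      {u \<in> space unif_seq. \<forall>k\<in>{..<n}. u (id k) \<in> C k}"
    using True by (auto simp: rpath_eq_iff follows_def C_def e_def)
  moreover have "emeasure unif_seq \<dots> = (\<Prod>k<n. emeasure unif (C k))"
    unfolding unif_seq_def using C by (intro emeasure_PiM_inj prob_space_unif) auto
  moreover have "{U \<in> space site_unif. rpath (\<lambda>_. arrows (\<omega>, U)) n = p} =
      {U \<in> space site_unif. \<forall>k\<in>{..<n}. U (fst (e k)) (snd (e k)) \<in> C k}"
    using True by (auto simp: rpath_eq_iff follows_def C_def e_def arrows_def)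
  moreover have "emeasure site_unif \<dots> = (\<Prod>k<n. emeasure unif (C k))"
    using C inj by (intro emeasure_site_unif_inj) auto
  ultimately show ?thesis by simp
qed

text \<open>Lists of integers form a countable type, so it suffices to treat preimages of single
  lists, which \<open>rpath_eq_iff\<close> describes by finitely many conditions.\<close>

lemma measurable_rpath:
  assumes [measurable]: "\<And>n y k. Measurable.pred M (\<lambda>\<xi>. r \<xi> n y k)"
  shows "(\<lambda>\<xi>. rpath (r \<xi>) n) \<in> measurable M (count_space UNIV)"
proof -
  have [measurable]: "Measurable.pred M (\<lambda>\<xi>. follows (r \<xi>) p k)" for p k
    unfolding follows_def by measurable
  have "(\<lambda>\<xi>. rpath (r \<xi>) n) -` {p} \<inter> space M \<in> sets M" for p
  proof -
    have "Measurable.pred M (\<lambda>\<xi>. length p = Suc n \<and> p ! 0 = 0 \<and> (\<forall>k<n. follows (r \<xi>) p k))"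
      by measurable
    moreover have "(\<lambda>\<xi>. rpath (r \<xi>) n) -` {p} \<inter> space M =
        {\<xi> \<in> space M. length p = Suc n \<and> p ! 0 = 0 \<and> (\<forall>k<n. follows (r \<xi>) p k)}"
      by (rule set_eqI) (simp add: rpath_eq_iff conj_commute)
    ultimately show ?thesis by simp
  qed
  then show ?thesis by (simp add: measurable_count_space_eq2_countable)
qed

lemma measurable_rwalk:
  assumes "\<And>n y k. Measurable.pred M (\<lambda>\<xi>. r \<xi> n y k)"
  shows "(\<lambda>\<xi>. rwalk (r \<xi>)) \<in> measurable M path_space"
  unfolding path_space_def
proof (rule measurable_PiM_single')
  show "(\<lambda>\<xi>. rwalk (r \<xi>) n) \<in> measurable M (count_space UNIV)" for n
    unfolding rwalk_def using measurable_rpath[OF assms] by (rule measurable_compose) simp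
qed (auto simp: space_PiM)

lemma measurable_cwalk [measurable]:
  assumes "sets Pe = sets env_space"
  shows "(\<lambda>\<xi>. cwalk (fst \<xi>) (snd \<xi>) 0) \<in> measurable (annealed Pe) path_space"
proof -
  note [measurable_cong] = assms
  show ?thesis unfolding cwalk_eq_rwalk annealed_def by (rule measurable_rwalk) measurable
qed

lemma measurable_site_walk [measurable]:
  assumes "sets Pe = sets env_space"
  shows "site_walk \<in> measurable (Pe \<Otimes>\<^sub>M site_unif) path_space"
proof -
  note [measurable_cong] = assms
  show ?thesis unfolding site_walk_def[abs_def] by (rule measurable_rwalk) (unfold arrows_def, measurable)
qed

text \<open>A cookie uses a fresh uniform variable whether these are indexed by time or by site and visit,
  so both drivings give the same path probabilities in every environment.\<close>
lemma walk_law_eq: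
  assumes "prob_space Pe" and sets_Pe: "sets Pe = sets env_space"
  shows "distr (annealed Pe) path_space (\<lambda>\<xi>. cwalk (fst \<xi>) (snd \<xi>) 0) =
    distr (Pe \<Otimes>\<^sub>M site_unif) path_space site_walk"
proof -
  note [measurable_cong] = sets_Pe
  interpret Pe: prob_space Pe by fact
  interpret U: prob_space unif_seq by (rule prob_space_unif_seq)
  interpret V: prob_space site_unif by (rule prob_space_site_unif)
  interpret PU: pair_prob_space Pe unif_seq ..
  interpret PV: pair_prob_space Pe site_unif ..
  let ?r1 = "\<lambda>\<xi> n y k. snd \<xi> n < fst \<xi> y k" and ?r2 = "\<lambda>\<xi> (_::nat). arrows \<xi>"
  have m1: "(\<lambda>\<xi>. rpath (?r1 \<xi>) n) \<in> measurable (Pe \<Otimes>\<^sub>M unif_seq) (count_space UNIV)" for n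
    by (rule measurable_rpath) measurable
  have m2: "(\<lambda>\<xi>. rpath (?r2 \<xi>) n) \<in> measurable (Pe \<Otimes>\<^sub>M site_unif) (count_space UNIV)" for n
    by (rule measurable_rpath) (unfold arrows_def, measurable)
  have fin: "distr (Pe \<Otimes>\<^sub>M unif_seq) (count_space UNIV) (\<lambda>\<xi>. rpath (?r1 \<xi>) n) =
      distr (Pe \<Otimes>\<^sub>M site_unif) (count_space UNIV) (\<lambda>\<xi>. rpath (?r2 \<xi>) n)" for n
  proof (rule measure_eqI_countable[where A = UNIV])
    fix p :: "int list"
    let ?A1 = "(\<lambda>\<xi>. rpath (?r1 \<xi>) n) -` {p} \<inter> space (Pe \<Otimes>\<^sub>M unif_seq)"
    let ?A2 = "(\<lambda>\<xi>. rpath (?r2 \<xi>) n) -` {p} \<inter> space (Pe \<Otimes>\<^sub>M site_unif)"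
    have A1: "?A1 \<in> sets (Pe \<Otimes>\<^sub>M unif_seq)" by (rule measurable_sets[OF m1]) simp
    have A2: "?A2 \<in> sets (Pe \<Otimes>\<^sub>M site_unif)" by (rule measurable_sets[OF m2]) simp
    have "emeasure (Pe \<Otimes>\<^sub>M unif_seq) ?A1 = (\<integral>\<^sup>+\<omega>. emeasure unif_seq (Pair \<omega> -` ?A1) \<partial>Pe)"
      by (rule U.emeasure_pair_measure_alt[OF A1])
    also have "\<dots> = (\<integral>\<^sup>+\<omega>. emeasure site_unif (Pair \<omega> -` ?A2) \<partial>Pe)"
    proof (rule nn_integral_cong)
      fix \<omega> assume \<omega>: "\<omega> \<in> space Pe"
      have "Pair \<omega> -` ?A1 = {u \<in> space unif_seq. rpath (\<lambda>n y k. u n < \<omega> y k) n = p}"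
        using \<omega> by (auto simp: space_pair_measure)
      moreover have "Pair \<omega> -` ?A2 = {U \<in> space site_unif. rpath (\<lambda>_. arrows (\<omega>, U)) n = p}"
        using \<omega> by (auto simp: space_pair_measure)
      ultimately show "emeasure unif_seq (Pair \<omega> -` ?A1) = emeasure site_unif (Pair \<omega> -` ?A2)"
        by (simp only: path_law_quenched)
    qed
    also have "\<dots> = emeasure (Pe \<Otimes>\<^sub>M site_unif) ?A2"
      by (rule V.emeasure_pair_measure_alt[OF A2, symmetric])
    finally show "emeasure (distr (Pe \<Otimes>\<^sub>M unif_seq) (count_space UNIV) (\<lambda>\<xi>. rpath (?r1 \<xi>) n)) {p} =
        emeasure (distr (Pe \<Otimes>\<^sub>M site_unif) (count_space UNIV) (\<lambda>\<xi>. rpath (?r2 \<xi>) n)) {p}"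
      using m1 m2 by (simp add: emeasure_distr)
  qed simp_all
  let ?X = "\<lambda>\<xi>. cwalk (fst \<xi>) (snd \<xi>) 0"
  show ?thesis
    unfolding path_space_def
  proof (rule measure_eqI_PiM_infinite)
    fix J :: "nat set" and F :: "nat \<Rightarrow> int set"
    assume J: "finite J"
    obtain n where n: "\<And>j. j \<in> J \<Longrightarrow> j \<le> n" using J finite_nat_set_iff_bounded_le by auto
    \<comment> \<open>Describes the cylinder set through the path up to time \<open>n\<close>, whose
      law is already known to agree.\<close>
    define B where "B = {p::int list. \<forall>j\<in>J. p ! j \<in> F j}"
    define E where "E = prod_emb UNIV (\<lambda>_::nat. count_space UNIV) J (Pi\<^sub>E J F)"
    have E_iff: "w \<in> E \<longleftrightarrow> (\<forall>j\<in>J. w j \<in> F j)" for w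
      by (auto simp: E_def prod_emb_def PiE_iff space_PiM)
    have E: "E \<in> sets path_space"
      unfolding E_def path_space_def using J by (intro sets_PiM_I) auto
    have path: "rpath r n \<in> B \<longleftrightarrow> rwalk r \<in> E" for r
      using n by (auto simp: B_def E_iff rpath_eq_map le_imp_less_Suc simp del: upt_Suc)
    have "emeasure (distr (annealed Pe) path_space ?X) E = emeasure (Pe \<Otimes>\<^sub>M unif_seq) (?X -` E \<inter> space (annealed Pe))"
      using E by (subst emeasure_distr) (auto simp: sets_Pe annealed_def[symmetric])
    also have "?X -` E \<inter> space (annealed Pe) = (\<lambda>\<xi>. rpath (?r1 \<xi>) n) -` B \<inter> space (Pe \<Otimes>\<^sub>M unif_seq)"
      by (auto simp: path cwalk_eq_rwalk annealed_def)
    also have "emeasure (Pe \<Otimes>\<^sub>M unif_seq) \<dots> =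
        emeasure (distr (Pe \<Otimes>\<^sub>M unif_seq) (count_space UNIV) (\<lambda>\<xi>. rpath (?r1 \<xi>) n)) B"
      using m1 by (simp add: emeasure_distr)
    also have "\<dots> = emeasure (Pe \<Otimes>\<^sub>M site_unif) ((\<lambda>\<xi>. rpath (?r2 \<xi>) n) -` B \<inter> space (Pe \<Otimes>\<^sub>M site_unif))"
      unfolding fin using m2 by (simp add: emeasure_distr)
    also have "(\<lambda>\<xi>. rpath (?r2 \<xi>) n) -` B \<inter> space (Pe \<Otimes>\<^sub>M site_unif) = site_walk -` E \<inter> space (Pe \<Otimes>\<^sub>M site_unif)"
      by (auto simp: path site_walk_def)
    also have "emeasure (Pe \<Otimes>\<^sub>M site_unif) \<dots> = emeasure (distr (Pe \<Otimes>\<^sub>M site_unif) path_space site_walk) E"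
      using E by (subst emeasure_distr) (auto simp: sets_Pe)
    finally show "emeasure (distr (annealed Pe) (Pi\<^sub>M UNIV (\<lambda>_. count_space UNIV)) ?X)
        (prod_emb UNIV (\<lambda>_. count_space UNIV) J (Pi\<^sub>E J F)) =
      emeasure (distr (Pe \<Otimes>\<^sub>M site_unif) (Pi\<^sub>M UNIV (\<lambda>_. count_space UNIV)) site_walk)
        (prod_emb UNIV (\<lambda>_. count_space UNIV) J (Pi\<^sub>E J F))"
      unfolding E_def path_space_def .
  next
    show "finite_measure (distr (annealed Pe) (Pi\<^sub>M UNIV (\<lambda>_. count_space UNIV)) ?X)"
      unfolding path_space_def[symmetric] using measurable_cwalk[OF sets_Pe]
      by (intro prob_space.finite_measure prob_space.prob_space_distr)
        (auto simp: annealed_def PU.prob_space_axioms)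
  qed simp_all
qed

section \<open>Comparison with the simple random walk\<close>

definition srw :: "(nat \<Rightarrow> real) \<Rightarrow> nat \<Rightarrow> int" where
  "srw u n = (\<Sum>i<n. if u i < 1/2 then 1 else - 1)"

lemma srw_0 [simp]: "srw u 0 = 0"
  by (simp add: srw_def)

lemma srw_Suc: "srw u (Suc n) = srw u n + (if u n < 1/2 then 1 else - 1)"
  by (simp add: srw_def)

lemma srw_case_nat: "srw (case_nat s w) (Suc n) = (if s < 1/2 then 1 else - 1) + srw w n"
  unfolding srw_def sum.lessThan_Suc_shift by simp

lemma measurable_srw [measurable]: "(\<lambda>u. srw u n) \<in> measurable unif_seq (count_space UNIV)"
proof (induction n)
  case (Suc n)
  note [measurable] = Suc
  show ?case unfolding srw_Suc by measurable
qed simp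

lemma measure_unif_half: "measure unif {..<1/2} = 1/2" "measure unif {1/2..} = 1/2"
proof -
  have "{0..1::real} \<inter> {..<1/2} = {0..<1/2}" "{0..1::real} \<inter> {1/2..} = {1/2..1}" by auto
  then show "measure unif {..<1/2} = 1/2" "measure unif {1/2..} = 1/2"
    by (simp_all add: measure_uniform_measure)
qed

text \<open>The probability of staying below \<open>x\<close> is a bounded harmonic function of \<open>x\<close> vanishing at \<open>0\<close>.\<close>
lemma srw_stays_below_prob: "emeasure unif_seq {u \<in> space unif_seq. \<forall>n. srw u n < int x} = 0"
proof -
  interpret N: prob_space unif by (rule prob_space_unif)
  interpret sequence_space unif by unfold_locales
  interpret S: prob_space unif_seq by (rule prob_space_unif_seq)
  define A where "A x = {u \<in> space unif_seq. \<forall>n. srw u n < int x}" for x :: nat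
  have A [measurable]: "A x \<in> sets unif_seq" for x unfolding A_def by measurable
  define h where "h x = measure unif_seq (A x)" for x
  have A0: "A 0 = {}" unfolding A_def by (auto intro: exI[of _ 0])
  have rec: "h (Suc x) = (h x + h (Suc (Suc x))) / 2" for x
  proof -
    let ?f = "\<lambda>(s, w). case_nat s w"
    have f: "?f \<in> measurable (unif \<Otimes>\<^sub>M unif_seq) unif_seq"
      unfolding unif_seq_def by measurable
    let ?B = "?f -` A (Suc x) \<inter> space (unif \<Otimes>\<^sub>M unif_seq)"
    have iff: "case_nat s w \<in> A (Suc x) \<longleftrightarrow> (if s < 1/2 then w \<in> A x else w \<in> A (Suc (Suc x)))"
      if "w \<in> space unif_seq" for s w
    proof -
      \<comment> \<open>Time \<open>0\<close> can be left out because the walk starts at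
        \<open>0\<close>, below \<open>Suc x\<close>; this is where the recursion needs a positive
        level.\<close>
      have "(\<forall>n. srw (case_nat s w) n < int (Suc x)) \<longleftrightarrow> (\<forall>n. srw (case_nat s w) (Suc n) < int (Suc x))"
        by (metis not0_implies_Suc of_nat_0_less_iff srw_0 zero_less_Suc)
      also have "\<dots> \<longleftrightarrow> (if s < 1/2 then \<forall>n. srw w n < int x else \<forall>n. srw w n < int (Suc (Suc x)))"
        by (auto simp: srw_case_nat algebra_simps)
      moreover have "case_nat s w \<in> space unif_seq"
        by (simp add: unif_seq_def space_PiM)
      ultimately show ?thesis using that by (simp add: A_def)
    qed
    have "emeasure unif_seq (A (Suc x)) = emeasure (distr (unif \<Otimes>\<^sub>M unif_seq) unif_seq ?f) (A (Suc x))"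
      using PiM_iter by (simp add: unif_seq_def)
    also have "\<dots> = emeasure (unif \<Otimes>\<^sub>M unif_seq) ?B"
      using f by (rule emeasure_distr) measurable
    also have "\<dots> = (\<integral>\<^sup>+s. emeasure unif_seq (Pair s -` ?B) \<partial>unif)"
      by (rule S.emeasure_pair_measure_alt, rule measurable_sets[OF f A])
    also have "\<dots> = (\<integral>\<^sup>+s. emeasure unif_seq (A x) * indicator {..<1/2} s +
        emeasure unif_seq (A (Suc (Suc x))) * indicator {1/2..} s \<partial>unif)"
    proof (rule nn_integral_cong)
      fix s assume "s \<in> space unif"
      then have "Pair s -` ?B = {w \<in> space unif_seq. case_nat s w \<in> A (Suc x)}"
        by (auto simp: space_pair_measure)
      also have "\<dots> = (if s < 1/2 then A x else A (Suc (Suc x)))"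
      proof (rule set_eqI)
        fix w
        have "A y \<subseteq> space unif_seq" for y by (auto simp: A_def)
        then show "w \<in> {w \<in> space unif_seq. case_nat s w \<in> A (Suc x)} \<longleftrightarrow>
            w \<in> (if s < 1/2 then A x else A (Suc (Suc x)))"
          using iff[of w s] by (cases "w \<in> space unif_seq") auto
      qed
      finally show "emeasure unif_seq (Pair s -` ?B) = emeasure unif_seq (A x) * indicator {..<1/2} s +
          emeasure unif_seq (A (Suc (Suc x))) * indicator {1/2..} s" by simp
    qed
    also have "\<dots> = emeasure unif_seq (A x) * ennreal (1/2) + emeasure unif_seq (A (Suc (Suc x))) * ennreal (1/2)"
    proof -
      have half: "emeasure unif {..<1/2} = ennreal (1/2)" "emeasure unif {1/2..} = ennreal (1/2)"
        unfolding N.emeasure_eq_measure measure_unif_half by (rule refl)+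
      have "(\<integral>\<^sup>+s. c * indicator {..<1/2} s + d * indicator {1/2..} s \<partial>unif) =
          c * ennreal (1/2) + d * ennreal (1/2)" for c d
      proof -
        have "(\<integral>\<^sup>+s. c * indicator {..<1/2} s + d * indicator {1/2..} s \<partial>unif) =
            (\<integral>\<^sup>+s. c * indicator {..<1/2} s \<partial>unif) + (\<integral>\<^sup>+s. d * indicator {1/2..} s \<partial>unif)"
          by (rule nn_integral_add)
            (rule borel_measurable_times_ennreal; rule borel_measurable_const borel_measurable_indicator; simp)+
        also have "(\<integral>\<^sup>+s. c * indicator {..<1/2} s \<partial>unif) = c * emeasure unif {..<1/2}"
          by (rule nn_integral_cmult_indicator) measurable
        also have "(\<integral>\<^sup>+s. d * indicator {1/2..} s \<partial>unif) = d * emeasure unif {1/2..}"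
          by (rule nn_integral_cmult_indicator) measurable
        finally show ?thesis unfolding half .
      qed
      then show ?thesis .
    qed
    finally have step: "emeasure unif_seq (A (Suc x)) =
        emeasure unif_seq (A x) * ennreal (1/2) + emeasure unif_seq (A (Suc (Suc x))) * ennreal (1/2)" .
    have "ennreal (h (Suc x)) = ennreal (h x * (1/2) + h (Suc (Suc x)) * (1/2))"
    proof -
      have "ennreal (h x * (1/2) + h (Suc (Suc x)) * (1/2)) =
          ennreal (h x * (1/2)) + ennreal (h (Suc (Suc x)) * (1/2))"
        by (rule ennreal_plus) (simp_all add: h_def)
      also have "\<dots> = ennreal (h x) * ennreal (1/2) + ennreal (h (Suc (Suc x))) * ennreal (1/2)"
        by (subst (1 2) ennreal_mult'') simp_all
      finally have "ennreal (h x * (1/2) + h (Suc (Suc x)) * (1/2)) =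
          ennreal (h x) * ennreal (1/2) + ennreal (h (Suc (Suc x))) * ennreal (1/2)" .
      then show ?thesis using step unfolding S.emeasure_eq_measure h_def by simp
    qed
    then have "h (Suc x) = h x * (1/2) + h (Suc (Suc x)) * (1/2)"
      by (subst (asm) ennreal_inj) (auto simp: h_def)
    then show ?thesis by simp
  qed
  \<comment> \<open>The recursion together with \<open>h 0 = 0\<close> forces \<open>h\<close> to be
    linear, and a probability cannot grow linearly unless the slope vanishes.\<close>
  have lin: "h x = real x * h 1 \<and> h (Suc x) = real (Suc x) * h 1" for x
  proof (induction x)
    case 0
    then show ?case by (simp add: h_def A0)
  next
    case (Suc x)
    then show ?case using rec[of x] by (simp add: algebra_simps)
  qed
  have "h 1 = 0"
  proof (rule ccontr)
    assume "h 1 \<noteq> 0"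
    then have pos: "0 < h 1" by (simp add: h_def zero_less_measure_iff)
    obtain n :: nat where n: "1 / h 1 < real n" using reals_Archimedean2 by blast
    have "1 < real n * h 1" using n pos by (simp add: field_simps)
    moreover have "h n \<le> 1" by (simp add: h_def)
    ultimately show False using lin[of n] by simp
  qed
  then have "h x = 0" using lin[of x] by simp
  then show ?thesis by (simp add: h_def S.emeasure_eq_measure A_def)
qed

lemma AE_srw_unbounded: "AE u in unif_seq. \<forall>x::nat. \<exists>n. int x \<le> srw u n"
proof -
  have "AE u in unif_seq. \<exists>n. int x \<le> srw u n" for x
  proof (rule AE_I[OF _ srw_stays_below_prob[of x]])
    show "{u \<in> space unif_seq. \<not> (\<exists>n. int x \<le> srw u n)} \<subseteq> {u \<in> space unif_seq. \<forall>n. srw u n < int x}"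
      by (auto simp: not_le)
  qed measurable
  then show ?thesis by (simp add: AE_all_countable)
qed

lemma AE_srw_lower:
  "AE u in unif_seq. \<forall>m::nat. eventually (\<lambda>n. - real n / real (Suc m) \<le> real_of_int (srw u n)) sequentially"
proof -
  interpret S: ergodic_map unif_seq seq_shift
    unfolding unif_seq_def by (rule ergodic_map_iid[OF prob_space_unif])
  interpret N: prob_space unif by (rule prob_space_unif)
  interpret product_prob_space "\<lambda>_::nat. unif" UNIV by unfold_locales
  \<comment> \<open>Minus the first step of the walk: \<open>birkhoff_upper\<close> bounds sums from
    above, and a lower bound for the walk is wanted.\<close>
  define f where "f u = (if u 0 < 1/2 then - 1 else 1 :: real)" for u :: "nat \<Rightarrow> real"
  have f [measurable]: "f \<in> borel_measurable unif_seq" unfolding f_def by measurable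
  have int_f: "integrable unif_seq f"
    by (rule S.integrable_const_bound[of _ 1]) (auto simp: f_def)
  let ?L = "{u \<in> space unif_seq. u 0 < 1/2}"
  have L: "?L \<in> sets unif_seq" by measurable
  have "emeasure unif_seq ?L = emeasure unif {..<1/2}"
    using emeasure_PiM_Collect_single[of 0 "{..<1/2}"] by (simp add: unif_seq_def)
  then have "S.prob ?L = measure unif {..<1/2}" by (simp only: measure_def)
  then have PL: "S.prob ?L = 1/2" by (simp only: measure_unif_half)
  have "S.expectation f = S.expectation (\<lambda>u. 1 - 2 * indicator ?L u)"
    by (rule Bochner_Integration.integral_cong) (auto simp: f_def)
  also have "\<dots> = 1 - 2 * S.prob ?L"
    using L by (subst Bochner_Integration.integral_diff)
      (auto simp: S.prob_space intro!: S.integrable_const_bound[of _ 1] borel_measurable_indicator)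
  finally have Ef: "S.expectation f = 0" using PL by simp
  have "AE u in unif_seq. eventually (\<lambda>n. - real n / real (Suc m) \<le> real_of_int (srw u n)) sequentially" for m
  proof -
    have "AE u in unif_seq. eventually (\<lambda>n. S.birkhoff_sum f n u \<le> real n * (S.expectation f + 1 / real (Suc m))) sequentially"
      by (rule S.birkhoff_upper[OF int_f]) simp
    then show ?thesis
    proof eventually_elim
      case (elim u)
      have B: "S.birkhoff_sum f n u = - real_of_int (srw u n)" for n
        unfolding S.birkhoff_sum_def srw_def
        by (simp add: f_def funpow_seq_shift sum_negf[symmetric] if_distrib cong: if_cong)
      show ?case
        using elim by (rule eventually_mono) (simp only: B Ef, simp)
    qed
  qed
  then show ?thesis by (simp add: AE_all_countable)
qed

text \<open>All cookies are at least \<open>1/2\<close>, so whenever the simple random walk steps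
  right, the cookie walk driven by the same uniforms does too.\<close>

lemma srw_le_cwalk:
  assumes "\<forall>x. \<forall>i\<ge>1. \<omega> x i \<in> {1/2..1}"
  shows "srw u n \<le> cwalk \<omega> u 0 n"
proof (induction n)
  case (Suc n)
  let ?y = "rwalk (\<lambda>n y k. u n < \<omega> y k)"
  have "1 \<le> visits ?y (?y n) (Suc n)" by (simp add: visits_Suc)
  then have "1/2 \<le> \<omega> (?y n) (visits ?y (?y n) (Suc n))" using assms by auto
  then show ?case using Suc unfolding cwalk_eq_rwalk by (auto simp: srw_Suc rwalk_Suc)
qed (simp add: cwalk_eq_rwalk)

text \<open>The comparison with the simple random walk is made for the time-driven walk, whereas
  hitting times are analysed for the site-driven one. What has to be carried over is therefore put
  as a measurable property of the path alone.\<close>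

definition good_path :: "(nat \<Rightarrow> int) \<Rightarrow> bool" where
  "good_path y \<longleftrightarrow> (\<forall>k. \<exists>n. y n = int k) \<and>
     (\<forall>m::nat. eventually (\<lambda>n. - real n / real (Suc m) \<le> real_of_int (y n)) sequentially)"

lemma rwalk_hits:
  assumes "int k \<le> rwalk r n"
  shows "\<exists>n. rwalk r n = int k"
proof -
  have "\<bar>rwalk r (Suc n) - rwalk r n\<bar> \<le> 1" for n by (simp add: rwalk_Suc)
  then show ?thesis using nat_intermed_int_val[of 0 n "rwalk r" "int k"] assms by auto
qed

lemma AE_pair_fst:
  assumes "prob_space N" "AE x in M. P x"
  shows "AE z in M \<Otimes>\<^sub>M N. P (fst z)"
  by (rule AE_distrD[OF measurable_fst]) (subst prob_space.distr_pair_fst[OF assms(1)], rule assms(2))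

lemma AE_pair_snd:
  assumes M: "prob_space M" and N: "prob_space N" and P: "AE x in N. P x"
  shows "AE z in M \<Otimes>\<^sub>M N. P (snd z)"
proof -
  interpret M: prob_space M by fact
  interpret N: prob_space N by fact
  have eq: "distr (M \<Otimes>\<^sub>M N) N snd = N"
  proof (rule measure_eqI)
    fix A assume "A \<in> sets (distr (M \<Otimes>\<^sub>M N) N snd)"
    then have A: "A \<in> sets N" by simp
    have "snd -` A \<inter> space (M \<Otimes>\<^sub>M N) = space M \<times> A"
      using sets.sets_into_space[OF A] by (auto simp: space_pair_measure)
    then show "emeasure (distr (M \<Otimes>\<^sub>M N) N snd) A = emeasure N A"
      using A by (simp add: emeasure_distr N.emeasure_pair_measure_Times M.emeasure_space_1)
  qed simp
  show ?thesis by (rule AE_distrD[OF measurable_snd]) (subst eq, rule P)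
qed

lemma AE_good_cwalk:
  assumes "prob_space Pe" "sets Pe = sets env_space" "AE \<omega> in Pe. \<forall>x. \<forall>i\<ge>1. \<omega> x i \<in> {1/2..1}"
  shows "AE \<xi> in annealed Pe. good_path (cwalk (fst \<xi>) (snd \<xi>) 0)"
proof -
  have "AE \<xi> in annealed Pe. \<forall>x. \<forall>i\<ge>1. fst \<xi> x i \<in> {1/2..1}"
    unfolding annealed_def by (rule AE_pair_fst[OF prob_space_unif_seq assms(3)])
  moreover have "AE \<xi> in annealed Pe. (\<forall>x::nat. \<exists>n. int x \<le> srw (snd \<xi>) n) \<and>
      (\<forall>m::nat. eventually (\<lambda>n. - real n / real (Suc m) \<le> real_of_int (srw (snd \<xi>) n)) sequentially)"
    unfolding annealed_def
    by (rule AE_pair_snd[OF assms(1) prob_space_unif_seq]) (use AE_srw_unbounded AE_srw_lower in eventually_elim, simp)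
  ultimately show ?thesis
  proof eventually_elim
    case (elim \<xi>)
    note le = srw_le_cwalk[OF elim(1), of "snd \<xi>"]
    have "\<exists>n. cwalk (fst \<xi>) (snd \<xi>) 0 n = int k" for k
    proof -
      obtain n where "int k \<le> srw (snd \<xi>) n" using elim(2) by blast
      then have "int k \<le> cwalk (fst \<xi>) (snd \<xi>) 0 n" using le[of n] by simp
      then show ?thesis unfolding cwalk_eq_rwalk by (rule rwalk_hits)
    qed
    moreover have "eventually (\<lambda>n. - real n / real (Suc m) \<le> real_of_int (cwalk (fst \<xi>) (snd \<xi>) 0 n)) sequentially" for m
      using elim(2)[THEN conjunct2, rule_format, of m]
      by (rule eventually_mono) (use le in \<open>meson of_int_le_iff order_trans\<close>)
    ultimately show ?case by (simp add: good_path_def)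
  qed
qed

section \<open>From hitting times to the speed\<close>

text \<open>Removes the least element and the value infinity, leaving a countable combination of
  conditions on single coordinates; this gives measurability.\<close>

lemma hit_add_le_iff:
  "hit w l + enat c \<le> hit w k \<longleftrightarrow> (\<forall>n. w n = k \<longrightarrow> (\<exists>m. w m = l \<and> m + c \<le> n))"
proof
  assume le: "hit w l + enat c \<le> hit w k"
  show "\<forall>n. w n = k \<longrightarrow> (\<exists>m. w m = l \<and> m + c \<le> n)"
  proof (intro allI impI)
    fix n assume n: "w n = k"
    then have "hit w k \<le> enat n" by (auto simp: hit_def intro: Least_le)
    with le have le': "hit w l + enat c \<le> enat n" by (rule order_trans)
    then have ex: "\<exists>m. w m = l" by (auto simp: hit_def split: if_splits)
    then have "w (LEAST m. w m = l) = l" by (rule LeastI_ex)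
    moreover have "(LEAST m. w m = l) + c \<le> n" using le' ex by (simp add: hit_def)
    ultimately show "\<exists>m. w m = l \<and> m + c \<le> n" by blast
  qed
next
  assume *: "\<forall>n. w n = k \<longrightarrow> (\<exists>m. w m = l \<and> m + c \<le> n)"
  show "hit w l + enat c \<le> hit w k"
  proof (cases "\<exists>n. w n = k")
    case True
    then have "w (LEAST n. w n = k) = k" by (rule LeastI_ex)
    with * obtain m where m: "w m = l" "m + c \<le> (LEAST n. w n = k)" by blast
    moreover have "(LEAST m. w m = l) \<le> m" using m(1) by (rule Least_le)
    ultimately show ?thesis using True by (auto simp: hit_def)
  qed (simp add: hit_def)
qed

context upward_path
begin

text \<open>The level \<open>K n\<close> is the maximum of the path up to time
  \<open>n\<close>.\<close>

lemma levels:
  obtains K where "\<And>n. T (K n) \<le> n" "\<And>n. n < T (Suc (K n))" "filterlim K at_top sequentially"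
proof -
  have "\<exists>k. T k \<le> n \<and> n < T (Suc k)" for n using level_exists[of n] by blast
  then obtain K where K: "\<And>n. T (K n) \<le> n" "\<And>n. n < T (Suc (K n))" by metis
  have "filterlim K at_top sequentially"
    unfolding filterlim_at_top
  proof
    fix c
    show "eventually (\<lambda>n. c \<le> K n) sequentially"
    proof (rule eventually_sequentiallyI[of "T c"])
      fix n assume n: "T c \<le> n"
      show "c \<le> K n"
      proof (rule ccontr)
        assume "\<not> c \<le> K n"
        then have "T (Suc (K n)) \<le> T c" using T_mono[of "Suc (K n)" c] by (cases "Suc (K n) = c") auto
        then show False using n K(2)[of n] by simp
      qed
    qed
  qed
  with K that show ?thesis by blast
qed

lemma ratio_bounds:
  assumes "T k \<le> n" "n < T (Suc k)" "1 \<le> k"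
  shows "real_of_int (y n) / real n \<le> real k / real (T k)"
    "real k / real (T (Suc k)) - (real (T (Suc k)) - real (T k)) / real (T k) \<le> real_of_int (y n) / real n"
proof -
  have pos: "0 < real (T k)" "0 < real n" "real (T k) \<le> real n" "real n \<le> real (T (Suc k))"
    using T_ge[of k] assms by auto
  have TT: "real (T k) \<le> real (T (Suc k))" using pos by linarith
  have "real_of_int (y n) / real n \<le> real k / real n"
    using speed_squeeze(1)[OF assms(1,2)] pos by (intro divide_right_mono) auto
  also have "\<dots> \<le> real k / real (T k)" using pos by (intro divide_left_mono) auto
  finally show "real_of_int (y n) / real n \<le> real k / real (T k)" .
  \<comment> \<open>The positive term is divided by the larger hitting time and the subtracted one
    by the smaller, so that the bound depends on \<open>k\<close> only.\<close>
  have "real k / real (T (Suc k)) - (real (T (Suc k)) - real (T k)) / real (T k) \<le>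
      real k / real n - (real (T (Suc k)) - real (T k)) / real n"
    using pos TT by (intro diff_mono divide_left_mono) auto
  also have "\<dots> = (real k - (real (T (Suc k)) - real (T k))) / real n"
    by (simp add: diff_divide_distrib)
  also have "\<dots> \<le> real_of_int (y n) / real n"
    using speed_squeeze(2)[OF assms(1,2)] pos TT by (intro divide_right_mono) (linarith, simp)
  finally show "real k / real (T (Suc k)) - (real (T (Suc k)) - real (T k)) / real (T k) \<le> real_of_int (y n) / real n" .
qed

lemma speed_finite:
  assumes lim: "(\<lambda>k. real (T k) / real k) \<longlonglongrightarrow> w" and w: "0 < w"
  shows "(\<lambda>n. real_of_int (y n) / real n) \<longlonglongrightarrow> 1 / w"
proof -
  obtain K where K: "\<And>n. T (K n) \<le> n" "\<And>n. n < T (Suc (K n))" "filterlim K at_top sequentially"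
    using levels by blast
  have inv: "(\<lambda>k. real k / real (T k)) \<longlonglongrightarrow> 1 / w"
    using tendsto_inverse[OF lim] w by (simp add: inverse_eq_divide)
  have S: "(\<lambda>k. real (T (Suc k)) / real (Suc k)) \<longlonglongrightarrow> w" by (rule LIMSEQ_Suc[OF lim])
  have invS: "(\<lambda>k. real (Suc k) / real (T (Suc k))) \<longlonglongrightarrow> 1 / w" by (rule LIMSEQ_Suc[OF inv])
  have r: "(\<lambda>k. real k / real (Suc k)) \<longlonglongrightarrow> 1" by (rule LIMSEQ_n_over_Suc_n)
  have r': "(\<lambda>k. real (Suc k) / real k) \<longlonglongrightarrow> 1" by (rule LIMSEQ_Suc_n_over_n)
  \<comment> \<open>The lower bound of \<open>ratio_bounds\<close>, rewritten by quotients with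
    known limits: the waiting time relative to \<open>T k\<close> tends to
    \<open>w * 1 * (1 / w) - 1 = 0\<close>.\<close>
  have "(\<lambda>k. (real k / real (Suc k)) * (real (Suc k) / real (T (Suc k))) -
      ((real (T (Suc k)) / real (Suc k)) * (real (Suc k) / real k) * (real k / real (T k)) - 1))
    \<longlonglongrightarrow> 1 * (1 / w) - (w * 1 * (1 / w) - 1)"
    by (intro tendsto_intros r r' S inv invS)
  then have "(\<lambda>k. (real k / real (Suc k)) * (real (Suc k) / real (T (Suc k))) -
      ((real (T (Suc k)) / real (Suc k)) * (real (Suc k) / real k) * (real k / real (T k)) - 1)) \<longlonglongrightarrow> 1 / w"
    using w by simp
  moreover have "eventually (\<lambda>k. (real k / real (Suc k)) * (real (Suc k) / real (T (Suc k))) -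
      ((real (T (Suc k)) / real (Suc k)) * (real (Suc k) / real k) * (real k / real (T k)) - 1) =
      real k / real (T (Suc k)) - (real (T (Suc k)) - real (T k)) / real (T k)) sequentially"
    using eventually_ge_at_top[of 1]
  proof eventually_elim
    case (elim k)
    then have "T k \<noteq> 0" using T_ge[of k] by simp
    then show ?case using elim by (simp add: diff_divide_distrib del: of_nat_Suc)
  qed
  ultimately have low: "(\<lambda>k. real k / real (T (Suc k)) - (real (T (Suc k)) - real (T k)) / real (T k)) \<longlonglongrightarrow> 1 / w"
    by (rule Lim_transform_eventually)
  have ge1: "eventually (\<lambda>n. 1 \<le> K n) sequentially"
    using K(3) unfolding filterlim_at_top by blast
  show ?thesis
  proof (rule tendsto_sandwich)
    show "(\<lambda>n. real (K n) / real (T (Suc (K n))) - (real (T (Suc (K n))) - real (T (K n))) / real (T (K n))) \<longlonglongrightarrow> 1 / w"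
      by (rule filterlim_compose[OF low K(3)])
    show "(\<lambda>n. real (K n) / real (T (K n))) \<longlonglongrightarrow> 1 / w"
      by (rule filterlim_compose[OF inv K(3)])
    show "eventually (\<lambda>n. real_of_int (y n) / real n \<le> real (K n) / real (T (K n))) sequentially"
      using ge1 by (rule eventually_mono) (rule ratio_bounds(1)[OF K(1,2)])
    show "eventually (\<lambda>n. real (K n) / real (T (Suc (K n))) -
        (real (T (Suc (K n))) - real (T (K n))) / real (T (K n)) \<le> real_of_int (y n) / real n) sequentially"
      using ge1 by (rule eventually_mono) (rule ratio_bounds(2)[OF K(1,2)])
  qed
qed

text \<open>Superlinear hitting times bound the speed from above only: the waiting times need not be
  small compared with \<open>T k\<close>, so \<open>ratio_bounds\<close> gives no useful lower
  bound, and one is assumed instead.\<close>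

lemma speed_zero:
  assumes fast: "\<And>c::nat. eventually (\<lambda>k. real c * real k \<le> real (T k)) sequentially"
    and lower: "\<And>m::nat. eventually (\<lambda>n. - real n / real (Suc m) \<le> real_of_int (y n)) sequentially"
  shows "(\<lambda>n. real_of_int (y n) / real n) \<longlonglongrightarrow> 0"
proof (rule LIMSEQ_I)
  fix e :: real assume "0 < e"
  then obtain m :: nat where m: "1 / real (Suc m) < e" using nat_approx_posE by blast
  obtain K where K: "\<And>n. T (K n) \<le> n" "\<And>n. n < T (Suc (K n))" "filterlim K at_top sequentially"
    using levels by blast
  have "eventually (\<lambda>k. real (Suc m) * real k \<le> real (T k) \<and> 1 \<le> k) sequentially"
    using fast[of "Suc m"] eventually_ge_at_top[of 1] by (rule eventually_conj)
  then have "eventually (\<lambda>n. real (Suc m) * real (K n) \<le> real (T (K n)) \<and> 1 \<le> K n) sequentially"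
    using K(3) by (rule eventually_compose_filterlim)
  then have "eventually (\<lambda>n. norm (real_of_int (y n) / real n - 0) < e) sequentially"
    using lower[of m] eventually_ge_at_top[of 1]
  proof eventually_elim
    case (elim n)
    then have Tpos: "0 < real (T (K n))" using T_ge[of "K n"] by simp
    have "real_of_int (y n) / real n \<le> real (K n) / real (T (K n))"
      using ratio_bounds(1)[OF K(1,2)] elim by blast
    also have "\<dots> \<le> 1 / real (Suc m)" using elim Tpos by (simp add: field_simps)
    finally have "real_of_int (y n) / real n \<le> 1 / real (Suc m)" .
    moreover have "- (1 / real (Suc m)) \<le> real_of_int (y n) / real n"
      using elim by (simp add: field_simps)
    ultimately show ?case using m by (simp add: abs_less_iff)
  qed
  then show "\<exists>no. \<forall>n\<ge>no. norm (real_of_int (y n) / real n - 0) < e"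
    by (simp add: eventually_sequentially)
qed

text \<open>Boundedly many visits to \<open>0\<close> before every level mean finitely many visits
  overall, and after the last of them the path cannot be negative.\<close>

lemma negative_time_bounded:
  assumes B: "\<And>k. visits y 0 (T k) \<le> B"
  shows "\<exists>N. \<forall>k. card {m. m < T k \<and> y m < 0} \<le> N"
proof -
  have "finite {n. y n = 0}"
  proof (rule ccontr)
    assume inf: "infinite {n. y n = 0}"
    then obtain Z where Z: "Z \<subseteq> {n. y n = 0}" "finite Z" "card Z = Suc B"
      using infinite_arbitrarily_large[OF inf, of "Suc B"] by metis
    obtain b where b: "\<forall>n\<in>Z. n < b" using Z(2) unfolding finite_nat_set_iff_bounded by auto
    have "Z \<subseteq> {m. m < T b \<and> y m = 0}"
    proof
      fix n assume "n \<in> Z"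
      then have "n < b" "y n = 0" using b Z(1) by auto
      then show "n \<in> {m. m < T b \<and> y m = 0}" using T_ge[of b] by simp
    qed
    then have "card Z \<le> visits y 0 (T b)" unfolding visits_def by (intro card_mono) auto
    then show False using B[of b] Z(3) by simp
  qed
  then obtain N where N: "\<forall>n\<in>{n. y n = 0}. n < N" unfolding finite_nat_set_iff_bounded by auto
  have "{m. m < T k \<and> y m < 0} \<subseteq> {..<N}" for k
  proof safe
    \<comment> \<open>To reach the level \<open>k\<close> from a negative site the path has to pass
      \<open>0\<close> again.\<close>
    fix n assume n: "n < T k" "y n < 0"
    then obtain c where "n \<le> c" "y c = 0" using intermediate[of n "T k" 0] by auto
    then have "c < N" using N by simp
    with \<open>n \<le> c\<close> show "n < N" by simp
  qed
  then have "card {m. m < T k \<and> y m < 0} \<le> N" for k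
    using card_mono[of "{..<N}"] by simp
  then show ?thesis by blast
qed

end

section \<open>Hitting and waiting times in terms of the arrows\<close>

context steered_path
begin

text \<open>For arbitrary arrows \<open>visits_origin\<close> may take junk values. Along an actual
  path it counts visits up to a hitting time, and these times increase with the level.\<close>

lemma visits_origin_mono_shift: "mono (\<lambda>m. visits_origin m ((seq_shift ^^ x) (\<lambda>n. a (int n))))"
proof (rule monoI)
  fix k l :: nat assume "k \<le> l"
  then have "T (x + k) \<le> T (x + l)" using T_mono[of "x + k" "x + l"] by (cases "k = l") auto
  then have "visits y (int x) (T (x + k)) \<le> visits y (int x) (T (x + l))"
    unfolding visits_def by (intro card_mono) auto
  then show "visits_origin k ((seq_shift ^^ x) (\<lambda>n. a (int n))) \<le> visits_origin l ((seq_shift ^^ x) (\<lambda>n. a (int n)))"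
    using visits_T[of x "x + k"] visits_T[of x "x + l"] by simp
qed

lemma time_eq:
  "T k = (\<Sum>x<k. visits_origin (k - x) ((seq_shift ^^ x) (\<lambda>n. a (int n)))) + card {m. m < T k \<and> y m < 0}"
  using time_decomposition[of k] by (simp add: visits_T)

lemma added_visits_exceeds_iff:
  assumes "j \<le> k"
  shows "j \<le> added_visits k (\<lambda>n. a (int n)) \<longleftrightarrow> j \<le> added_visits j ((seq_shift ^^ (k - j)) (\<lambda>n. a (int n)))"
proof -
  have "j \<le> card {n. T k \<le> n \<and> n < T (Suc k) \<and> int 0 \<le> y n} \<longleftrightarrow>
      j \<le> card {n. T k \<le> n \<and> n < T (Suc k) \<and> int (k - j) \<le> y n}"
    by (rule exceeds_iff[OF assms]) auto
  then show ?thesis using card_window_eq[of 0 k] card_window_eq[of "k - j" k] assms by simp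
qed

text \<open>The waiting time includes steps at negative sites, which \<open>added_visits\<close>
  ignores. A path that goes from \<open>j\<close> to a negative site has already met the
  \<open>j + 1\<close> sites from \<open>j\<close> down to \<open>0\<close>, so these steps cannot
  decide whether \<open>j\<close> is reached.\<close>

lemma waiting_time_exceeds_iff:
  "hit y (int j) + enat j \<le> hit y (int j + 1) \<longleftrightarrow> j \<le> added_visits j (\<lambda>n. a (int n))"
proof -
  have "hit y (int j + 1) = enat (T (Suc j))" using hit_eq[of "Suc j"] by (simp add: add.commute)
  then have "hit y (int j) + enat j \<le> hit y (int j + 1) \<longleftrightarrow> j \<le> card {T j..<T (Suc j)}"
    using T_mono[of j "Suc j"] by (auto simp: hit_eq)
  also have "\<dots> \<longleftrightarrow> j \<le> card {n. T j \<le> n \<and> n < T (Suc j) \<and> int (j - j) \<le> y n}"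
    by (rule exceeds_iff) auto
  also have "\<dots> \<longleftrightarrow> j \<le> added_visits j (\<lambda>n. a (int n))"
    using card_window_eq[of 0 j] by simp
  finally show ?thesis .
qed

lemma added_visits_shift_le:
  assumes "i \<le> k"
  shows "added_visits (k - i) ((seq_shift ^^ i) (\<lambda>n. a (int n))) \<le> added_visits k (\<lambda>n. a (int n))"
proof -
  have "card {n. T k \<le> n \<and> n < T (Suc k) \<and> int i \<le> y n} \<le> card {n. T k \<le> n \<and> n < T (Suc k) \<and> int 0 \<le> y n}"
    by (rule card_mono, rule finite_subset[of _ "{..<T (Suc k)}"]) auto
  then show ?thesis using card_window_eq[OF assms] card_window_eq[of 0 k] by simp
qed

end

lemma steered_site_walk:
  assumes "good_path (site_walk \<xi>)"
  shows "steered_path (site_walk \<xi>) (arrows \<xi>)"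
proof
  show "site_walk \<xi> 0 = 0" by (simp add: site_walk_def)
  show "site_walk \<xi> (Suc n) = site_walk \<xi> n + 1 \<or> site_walk \<xi> (Suc n) = site_walk \<xi> n - 1" for n
    by (simp add: site_walk_def rwalk_Suc)
  show "\<exists>n. site_walk \<xi> n = int k" for k using assms by (simp add: good_path_def)
  show "site_walk \<xi> (Suc n) = site_walk \<xi> n + 1 \<longleftrightarrow>
      arrows \<xi> (site_walk \<xi> n) (visits (site_walk \<xi>) (site_walk \<xi> n) (Suc n))" for n
    by (simp add: site_walk_def rwalk_Suc)
qed

lemma good_path_measurable [measurable]: "Measurable.pred path_space good_path"
proof -
  have [measurable]: "(\<lambda>w. w n) \<in> measurable path_space (count_space UNIV)" for n
    unfolding path_space_def by measurable
  show ?thesis unfolding good_path_def[abs_def] eventually_sequentially by measurable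
qed

lemma hit_event_measurable [measurable]: "Measurable.pred path_space (\<lambda>w. hit w l + enat c \<le> hit w k)"
proof -
  have [measurable]: "(\<lambda>w. w n) \<in> measurable path_space (count_space UNIV)" for n
    unfolding path_space_def by measurable
  show ?thesis unfolding hit_add_le_iff by measurable
qed

lemma speed_event_measurable [measurable]:
  "Measurable.pred path_space (\<lambda>w. (\<lambda>n. real_of_int (w n) / real n) \<longlonglongrightarrow> v)"
proof -
  have [measurable]: "(\<lambda>w. w n) \<in> measurable path_space (count_space UNIV)" for n
    unfolding path_space_def by measurable
  have [measurable]: "(\<lambda>w. real_of_int (w n) / real n) \<in> borel_measurable path_space" for n
    by measurable
  show ?thesis by measurable
qed

section \<open>Hitting times in a stationary ergodic environment\<close>

definition half_arrows :: "(nat \<Rightarrow> nat \<Rightarrow> real) \<times> (nat \<Rightarrow> nat \<Rightarrow> real) \<Rightarrow> nat \<Rightarrow> nat \<Rightarrow> bool" where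
  "half_arrows \<zeta> n i \<longleftrightarrow> snd \<zeta> n i < fst \<zeta> n i"

definition right_parts :: "env \<times> env \<Rightarrow> (nat \<Rightarrow> nat \<Rightarrow> real) \<times> (nat \<Rightarrow> nat \<Rightarrow> real)" where
  "right_parts \<xi> = (right_part (fst \<xi>), right_part (snd \<xi>))"

abbreviation shift2 :: "(nat \<Rightarrow> nat \<Rightarrow> real) \<times> (nat \<Rightarrow> nat \<Rightarrow> real) \<Rightarrow> (nat \<Rightarrow> nat \<Rightarrow> real) \<times> (nat \<Rightarrow> nat \<Rightarrow> real)"
  where "shift2 \<equiv> map_prod seq_shift seq_shift"

lemma half_arrows_right_parts: "(\<lambda>n. arrows \<xi> (int n)) = half_arrows (right_parts \<xi>)"
  by (auto simp: fun_eq_iff arrows_def half_arrows_def right_parts_def right_part_def)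

lemma seq_shift_half_arrows: "seq_shift (half_arrows \<zeta>) = half_arrows (shift2 \<zeta>)"
  by (auto simp: fun_eq_iff half_arrows_def seq_shift_def)

lemma funpow_shift_half_arrows: "(seq_shift ^^ i) (half_arrows \<zeta>) = half_arrows ((shift2 ^^ i) \<zeta>)"
  by (induction i) (simp_all add: seq_shift_half_arrows)

lemma space_seq_space [simp]: "space seq_space = UNIV"
  by (simp add: seq_space_def space_PiM)

lemma measurable_right_part [measurable]: "right_part \<in> measurable env_space seq_space"
  unfolding right_part_def env_space_def seq_space_def
  by (rule measurable_PiM_single') (auto simp: space_PiM)

definition site_unif_right :: "(nat \<Rightarrow> nat \<Rightarrow> real) measure" where
  "site_unif_right = Pi\<^sub>M UNIV (\<lambda>_::nat. Pi\<^sub>M UNIV (\<lambda>_::nat. unif))"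

lemma sets_site_unif_right [measurable_cong]: "sets site_unif_right = sets seq_space"
  unfolding site_unif_right_def seq_space_def by (intro sets_PiM_cong) simp_all

lemma prob_space_site_unif_right: "prob_space site_unif_right"
  unfolding site_unif_right_def by (intro prob_space_PiM prob_space_unif)

lemma distr_site_unif_right_part: "distr site_unif seq_space right_part = site_unif_right"
proof -
  have "distr site_unif site_unif_right (\<lambda>\<omega>. \<lambda>n\<in>UNIV. \<omega> (int n)) = site_unif_right"
    unfolding site_unif_def site_unif_right_def
    by (rule distr_PiM_reindex) (auto intro!: prob_space_PiM prob_space_unif)
  then show ?thesis
    by (simp add: right_part_def[abs_def] restrict_UNIV sets_site_unif_right cong: distr_cong)
qed

lemma measurable_seq_space_coord:
  assumes "f \<in> measurable M seq_space"
  shows "(\<lambda>x. f x n k) \<in> borel_measurable M"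
proof -
  have 1: "(\<lambda>w. w n) \<in> measurable seq_space (Pi\<^sub>M UNIV (\<lambda>_::nat. borel))"
    unfolding seq_space_def by measurable
  have 2: "(\<lambda>f. f k) \<in> measurable (Pi\<^sub>M UNIV (\<lambda>_::nat. borel :: real measure)) borel" by measurable
  have "(\<lambda>w. w n k) \<in> borel_measurable seq_space" using measurable_compose[OF 1 2] .
  from measurable_compose[OF assms this] show ?thesis .
qed

lemma pred_nat_rel:
  fixes f g :: "'a \<Rightarrow> nat"
  assumes [measurable]: "f \<in> measurable M (count_space UNIV)" "g \<in> measurable M (count_space UNIV)"
  shows "Measurable.pred M (\<lambda>x. R (f x) (g x))"
  by measurable

lemma measurable_success_index:
  assumes [measurable]: "\<And>i. Measurable.pred M (\<lambda>x. s x i)" "r \<in> measurable M (count_space UNIV)"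
  shows "(\<lambda>x. success_index (s x) (r x)) \<in> measurable M (count_space UNIV)"
proof -
  have c: "(\<lambda>x. card {i. 1 \<le> i \<and> i \<le> v \<and> s x i}) \<in> measurable M (count_space UNIV)" for v
  proof (induction v)
    case (Suc v)
    have "card {i. 1 \<le> i \<and> i \<le> Suc v \<and> s x i} = card {i. 1 \<le> i \<and> i \<le> v \<and> s x i} + (if s x (Suc v) then 1 else 0)" for x
    proof -
      have "{i. 1 \<le> i \<and> i \<le> Suc v \<and> s x i} = {i. 1 \<le> i \<and> i \<le> v \<and> s x i} \<union> (if s x (Suc v) then {Suc v} else {})"
        by (auto simp: le_Suc_eq)
      then show ?thesis by auto
    qed
    with Suc show ?case by simp
  qed (simp add: conj_commute)
  show ?thesis
    unfolding success_index_def
    by (rule measurable_Least, rule pred_nat_rel[where R = "(=)"]) (rule c assms)+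
qed

section \<open>Transfer between the walk and the data on the right half-line\<close>

locale cookie_environment = prob_space Pe for Pe :: "env measure" +
  assumes sets_Pe: "sets Pe = sets env_space"
    and cookies: "AE \<omega> in Pe. \<forall>x. \<forall>i\<ge>1. \<omega> x i \<in> {1/2..1}"
    and stat_erg: "stationary_ergodic_right Pe"
begin

definition joint :: "(env \<times> env) measure" where "joint = Pe \<Otimes>\<^sub>M site_unif"

text \<open>Stationarity and ergodicity are assumed on the right half-line only, so the shift acts
  on this image of \<open>joint\<close> and not on \<open>joint\<close> itself.\<close>

definition half :: "((nat \<Rightarrow> nat \<Rightarrow> real) \<times> (nat \<Rightarrow> nat \<Rightarrow> real)) measure" where
  "half = distr Pe seq_space right_part \<Otimes>\<^sub>M site_unif_right"

lemma right_part_Pe [measurable]: "right_part \<in> measurable Pe seq_space"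
  using measurable_right_part by (simp cong: measurable_cong_sets add: sets_Pe)

lemma ergodic_right: "ergodic_map (distr Pe seq_space right_part) seq_shift"
proof -
  let ?R = "distr Pe seq_space right_part"
  interpret R: prob_space ?R by (rule prob_space_distr) measurable
  have sh: "seq_shift \<in> measurable seq_space seq_space" unfolding seq_space_def by measurable
  show ?thesis
  proof
    show "seq_shift \<in> measurable ?R ?R" using sh by simp
    have "distr ?R ?R seq_shift = distr ?R seq_space seq_shift" by (rule distr_cong) simp_all
    also have "\<dots> = distr Pe seq_space (seq_shift \<circ> right_part)"
      by (rule distr_distr[OF sh right_part_Pe])
    finally show "distr ?R ?R seq_shift = ?R"
      using stat_erg by (simp add: stationary_ergodic_right_def)
    fix A assume "A \<in> sets ?R" "seq_shift -` A \<inter> space ?R = A"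
    then have A: "A \<in> sets seq_space" "seq_shift -` A \<inter> space seq_space = A" by simp_all
    then have "measure Pe (right_part -` A \<inter> space Pe) \<in> {0, 1}"
      using stat_erg unfolding stationary_ergodic_right_def by blast
    then show "R.prob A \<in> {0, 1}" using A by (simp add: measure_distr)
  qed
qed

lemma ergodic_half: "ergodic_map half shift2"
  unfolding half_def site_unif_right_def
  by (intro ergodic_map_times_iid ergodic_right prob_space_PiM prob_space_unif)

sublocale H: ergodic_map half shift2 by (rule ergodic_half)

lemma sets_half [measurable_cong]: "sets half = sets (seq_space \<Otimes>\<^sub>M seq_space)"
  unfolding half_def by (intro sets_pair_measure_cong) (simp_all add: sets_site_unif_right)

lemma sets_joint [measurable_cong]: "sets joint = sets (env_space \<Otimes>\<^sub>M env_space)"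
  unfolding joint_def by (intro sets_pair_measure_cong sets_Pe sets_site_unif)

lemma right_parts_measurable: "right_parts \<in> measurable joint half"
  unfolding right_parts_def[abs_def] by measurable

lemma distr_joint: "distr joint half right_parts = half"
proof -
  have m: "right_part \<in> measurable site_unif seq_space"
    using measurable_right_part by (simp cong: measurable_cong_sets add: sets_site_unif)
  have "half = distr Pe seq_space right_part \<Otimes>\<^sub>M distr site_unif seq_space right_part"
    unfolding half_def distr_site_unif_right_part ..
  also have "\<dots> = distr (Pe \<Otimes>\<^sub>M site_unif) (seq_space \<Otimes>\<^sub>M seq_space) (\<lambda>(x, y). (right_part x, right_part y))"
    by (rule pair_measure_distr[OF right_part_Pe m])
      (simp add: distr_site_unif_right_part prob_space_imp_sigma_finite prob_space_site_unif_right)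
  also have "\<dots> = distr joint half right_parts"
    unfolding joint_def by (rule distr_cong) (auto simp: sets_half right_parts_def)
  finally show ?thesis by simp
qed

text \<open>Properties of \<open>V\<close> and \<open>W\<close> that rely on an actual path are
  proved on \<open>joint\<close>, where the walk is defined, and then pushed forward to
  \<open>half\<close>, where the shift is defined.\<close>

lemma AE_half:
  assumes "Measurable.pred half P" "AE \<xi> in joint. P (right_parts \<xi>)"
  shows "AE \<zeta> in half. P \<zeta>"
proof -
  have "AE \<zeta> in distr joint half right_parts. P \<zeta>"
    using assms(1) by (subst AE_distr_iff[OF right_parts_measurable]) (auto intro: assms(2))
  then show ?thesis by (simp only: distr_joint)
qed

lemma AE_joint:
  assumes "AE \<zeta> in half. P \<zeta>"
  shows "AE \<xi> in joint. P (right_parts \<xi>)"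
  by (rule AE_distrD[OF right_parts_measurable]) (subst distr_joint, rule assms)

lemma emeasure_half:
  assumes "Measurable.pred half P"
  shows "emeasure half {\<zeta> \<in> space half. P \<zeta>} = emeasure joint {\<xi> \<in> space joint. P (right_parts \<xi>)}"
proof -
  have "emeasure half {\<zeta> \<in> space half. P \<zeta>} = emeasure (distr joint half right_parts) {\<zeta> \<in> space half. P \<zeta>}"
    by (simp only: distr_joint)
  also have "\<dots> = emeasure joint (right_parts -` {\<zeta> \<in> space half. P \<zeta>} \<inter> space joint)"
    using assms by (intro emeasure_distr right_parts_measurable) simp
  also have "right_parts -` {\<zeta> \<in> space half. P \<zeta>} \<inter> space joint = {\<xi> \<in> space joint. P (right_parts \<xi>)}"
    using measurable_space[OF right_parts_measurable] by auto
  finally show ?thesis .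
qed

lemma half_arrows_measurable [measurable]: "Measurable.pred half (\<lambda>\<zeta>. half_arrows \<zeta> n i)"
proof -
  have [measurable]: "(\<lambda>\<zeta>. fst \<zeta> n i) \<in> borel_measurable half" "(\<lambda>\<zeta>. snd \<zeta> n i) \<in> borel_measurable half"
    by (intro measurable_seq_space_coord; measurable)+
  show ?thesis unfolding half_arrows_def by measurable
qed

lemma left_jumps_measurable:
  "(\<lambda>\<zeta>. left_jumps m (half_arrows \<zeta>)) \<in> measurable half (count_space UNIV)"
proof (induction m)
  case (Suc m)
  have [measurable]: "(\<lambda>\<zeta>. left_jumps m (half_arrows (shift2 \<zeta>))) \<in> measurable half (count_space UNIV)"
    using measurable_compose[OF H.meas Suc] .
  have [measurable]: "(\<lambda>\<zeta>. success_index (half_arrows \<zeta> 0) (Suc (left_jumps m (half_arrows (shift2 \<zeta>))))) \<in> measurable half (count_space UNIV)"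
    by (rule measurable_success_index) measurable
  show ?case unfolding left_jumps.simps seq_shift_half_arrows by measurable
qed simp

text \<open>\<open>V m\<close> corresponds to the visits to \<open>0\<close> before \<open>T m\<close>, and \<open>W m\<close> to the time spent at nonnegative
  sites between \<open>T m\<close> and \<open>T (m + 1)\<close>.\<close>

definition V :: "nat \<Rightarrow> (nat \<Rightarrow> nat \<Rightarrow> real) \<times> (nat \<Rightarrow> nat \<Rightarrow> real) \<Rightarrow> nat" where
  "V m \<zeta> = visits_origin m (half_arrows \<zeta>)"

definition W :: "nat \<Rightarrow> (nat \<Rightarrow> nat \<Rightarrow> real) \<times> (nat \<Rightarrow> nat \<Rightarrow> real) \<Rightarrow> nat" where
  "W m \<zeta> = added_visits m (half_arrows \<zeta>)"

lemma V_0 [simp]: "V 0 \<zeta> = 0" by (simp add: V_def)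

lemma V_measurable [measurable]: "V m \<in> measurable half (count_space UNIV)"
proof (cases m)
  case (Suc m')
  have [measurable]: "(\<lambda>\<zeta>. left_jumps m' (half_arrows (shift2 \<zeta>))) \<in> measurable half (count_space UNIV)"
    using measurable_compose[OF H.meas left_jumps_measurable] .
  have "(\<lambda>\<zeta>. success_index (half_arrows \<zeta> 0) (Suc (left_jumps m' (half_arrows (shift2 \<zeta>))))) \<in> measurable half (count_space UNIV)"
    by (rule measurable_success_index) measurable
  then show ?thesis by (simp add: V_def[abs_def] visits_origin_def Suc seq_shift_half_arrows)
qed (simp add: V_def[abs_def])

lemma W_eq: "W m \<zeta> = (\<Sum>i\<le>m. V (Suc m - i) ((shift2 ^^ i) \<zeta>) - V (m - i) ((shift2 ^^ i) \<zeta>))"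
  unfolding W_def V_def added_visits_def funpow_shift_half_arrows ..

lemma V_shift_measurable [measurable]: "(\<lambda>\<zeta>. V m ((shift2 ^^ i) \<zeta>)) \<in> measurable half (count_space UNIV)"
  using measurable_compose[OF H.funpow_measurable V_measurable] .

lemma W_measurable [measurable]: "W m \<in> measurable half (count_space UNIV)"
  unfolding W_eq[abs_def] by measurable

lemma W_shift_measurable [measurable]: "(\<lambda>\<zeta>. W m ((shift2 ^^ i) \<zeta>)) \<in> measurable half (count_space UNIV)"
  using measurable_compose[OF H.funpow_measurable W_measurable] .

lemma site_walk_joint: "site_walk \<in> measurable joint path_space"
  unfolding joint_def by (rule measurable_site_walk[OF sets_Pe])

lemma AE_walks_iff:
  assumes "Measurable.pred path_space P"
  shows "(AE \<xi> in annealed Pe. P (cwalk (fst \<xi>) (snd \<xi>) 0)) \<longleftrightarrow> (AE \<xi> in joint. P (site_walk \<xi>))"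
proof -
  have P: "{w \<in> space path_space. P w} \<in> sets path_space" using assms by simp
  have "(AE \<xi> in annealed Pe. P (cwalk (fst \<xi>) (snd \<xi>) 0)) \<longleftrightarrow>
      (AE w in distr (annealed Pe) path_space (\<lambda>\<xi>. cwalk (fst \<xi>) (snd \<xi>) 0). P w)"
    by (rule AE_distr_iff[OF measurable_cwalk[OF sets_Pe] P, symmetric])
  also have "\<dots> \<longleftrightarrow> (AE w in distr joint path_space site_walk. P w)"
    unfolding joint_def by (subst walk_law_eq[OF prob_space_axioms sets_Pe]) (rule refl)
  also have "\<dots> \<longleftrightarrow> (AE \<xi> in joint. P (site_walk \<xi>))"
    by (rule AE_distr_iff[OF site_walk_joint P])
  finally show ?thesis .
qed

lemma emeasure_walks_eq:
  assumes "Measurable.pred path_space P"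
  shows "emeasure (annealed Pe) {\<xi> \<in> space (annealed Pe). P (cwalk (fst \<xi>) (snd \<xi>) 0)} =
    emeasure joint {\<xi> \<in> space joint. P (site_walk \<xi>)}"
proof -
  have P: "{w \<in> space path_space. P w} \<in> sets path_space" using assms by simp
  have *: "emeasure (distr N path_space X) {w \<in> space path_space. P w} = emeasure N {\<xi> \<in> space N. P (X \<xi>)}"
    if X: "X \<in> measurable N path_space" for N :: "'b measure" and X
  proof -
    have "X -` {w \<in> space path_space. P w} \<inter> space N = {\<xi> \<in> space N. P (X \<xi>)}"
      using measurable_space[OF X] by auto
    then show ?thesis using emeasure_distr[OF X P] by simp
  qed
  show ?thesis
    using *[OF measurable_cwalk[OF sets_Pe]] *[OF site_walk_joint] walk_law_eq[OF prob_space_axioms sets_Pe]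
    by (simp add: joint_def)
qed

lemma AE_steered: "AE \<xi> in joint. steered_path (site_walk \<xi>) (arrows \<xi>)"
proof -
  have "AE \<xi> in joint. good_path (site_walk \<xi>)"
    using AE_good_cwalk[OF prob_space_axioms sets_Pe cookies]
    by (subst (asm) AE_walks_iff) measurable
  then show ?thesis by eventually_elim (rule steered_site_walk)
qed

lemma AE_V_mono: "AE \<zeta> in half. \<forall>i m. V m ((shift2 ^^ i) \<zeta>) \<le> V (Suc m) ((shift2 ^^ i) \<zeta>)"
proof (rule AE_half)
  show "AE \<xi> in joint. \<forall>i m. V m ((shift2 ^^ i) (right_parts \<xi>)) \<le> V (Suc m) ((shift2 ^^ i) (right_parts \<xi>))"
    using AE_steered
  proof eventually_elim
    case (elim \<xi>)
    interpret steered_path "site_walk \<xi>" "arrows \<xi>" by fact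
    show ?case
      using visits_origin_mono_shift
      unfolding V_def half_arrows_right_parts funpow_shift_half_arrows by (auto intro: monoD)
  qed
qed (intro pred_intros_countable pred_nat_rel[where R = "(\<le>)"] V_shift_measurable)

section \<open>Tails of the waiting times and mean visit counts\<close>

definition q :: "nat \<Rightarrow> ennreal" where "q j = emeasure half {\<zeta> \<in> space half. j \<le> W j \<zeta>}"

lemma W_tail_eq:
  assumes "j \<le> k"
  shows "emeasure half {\<zeta> \<in> space half. j \<le> W k \<zeta>} = q j"
proof -
  have "AE \<zeta> in half. j \<le> W k \<zeta> \<longleftrightarrow> j \<le> W j ((shift2 ^^ (k - j)) \<zeta>)"
  proof (rule AE_half)
    show "AE \<xi> in joint. j \<le> W k (right_parts \<xi>) \<longleftrightarrow> j \<le> W j ((shift2 ^^ (k - j)) (right_parts \<xi>))"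
      using AE_steered
    proof eventually_elim
      case (elim \<xi>)
      interpret steered_path "site_walk \<xi>" "arrows \<xi>" by fact
      show ?case
        using added_visits_exceeds_iff[OF assms]
        unfolding W_def half_arrows_right_parts funpow_shift_half_arrows .
    qed
  qed measurable
  then have "emeasure half {\<zeta> \<in> space half. j \<le> W k \<zeta>} =
      emeasure half {\<zeta> \<in> space half. j \<le> W j ((shift2 ^^ (k - j)) \<zeta>)}"
    by (intro emeasure_eq_AE) (auto, measurable)
  also have "\<dots> = q j" unfolding q_def by (rule H.emeasure_funpow) measurable
  finally show ?thesis .
qed

text \<open>At a level \<open>k < j\<close> there are fewer than \<open>j\<close> sites between
  \<open>0\<close> and \<open>k\<close>. After a shift by \<open>j - k\<close> the same time is
  spent below level \<open>j + 1\<close>, and including the additional sites on the left can only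
  increase it.\<close>

lemma W_tail_le:
  assumes "k < j"
  shows "emeasure half {\<zeta> \<in> space half. j \<le> W k \<zeta>} \<le> q j"
proof -
  have "AE \<zeta> in half. W k ((shift2 ^^ (j - k)) \<zeta>) \<le> W j \<zeta>"
  proof (rule AE_half)
    show "AE \<xi> in joint. W k ((shift2 ^^ (j - k)) (right_parts \<xi>)) \<le> W j (right_parts \<xi>)"
      using AE_steered
    proof eventually_elim
      case (elim \<xi>)
      interpret steered_path "site_walk \<xi>" "arrows \<xi>" by fact
      have "j - (j - k) = k" "j - k \<le> j" using assms by auto
      then show ?case
        using added_visits_shift_le[of "j - k" j]
        unfolding W_def half_arrows_right_parts funpow_shift_half_arrows by simp
    qed
  qed (intro pred_nat_rel[where R = "(\<le>)"] W_shift_measurable W_measurable)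
  have "emeasure half {\<zeta> \<in> space half. j \<le> W k \<zeta>} =
      emeasure half {\<zeta> \<in> space half. j \<le> W k ((shift2 ^^ (j - k)) \<zeta>)}"
    by (rule H.emeasure_funpow[symmetric]) measurable
  also have "\<dots> \<le> q j"
    unfolding q_def
  proof (rule emeasure_mono_AE)
    show "AE \<zeta> in half. \<zeta> \<in> {\<zeta> \<in> space half. j \<le> W k ((shift2 ^^ (j - k)) \<zeta>)} \<longrightarrow> \<zeta> \<in> {\<zeta> \<in> space half. j \<le> W j \<zeta>}"
      using \<open>AE \<zeta> in half. W k ((shift2 ^^ (j - k)) \<zeta>) \<le> W j \<zeta>\<close> by eventually_elim auto
  qed measurable
  finally show ?thesis .
qed

lemma waiting_time_prob:
  "emeasure (annealed Pe) {\<xi> \<in> space (annealed Pe).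
     hit (cwalk (fst \<xi>) (snd \<xi>) 0) (int j + 1) \<ge> hit (cwalk (fst \<xi>) (snd \<xi>) 0) (int j) + enat j} = q j"
proof -
  have "emeasure (annealed Pe) {\<xi> \<in> space (annealed Pe).
     hit (cwalk (fst \<xi>) (snd \<xi>) 0) (int j + 1) \<ge> hit (cwalk (fst \<xi>) (snd \<xi>) 0) (int j) + enat j} =
     emeasure joint {\<xi> \<in> space joint. hit (site_walk \<xi>) (int j) + enat j \<le> hit (site_walk \<xi>) (int j + 1)}"
    by (rule emeasure_walks_eq[where P = "\<lambda>w. hit w (int j) + enat j \<le> hit w (int j + 1)"]) measurable
  also have "\<dots> = emeasure joint {\<xi> \<in> space joint. j \<le> W j (right_parts \<xi>)}"
  proof (rule emeasure_eq_AE)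
    show "AE \<xi> in joint. \<xi> \<in> {\<xi> \<in> space joint. hit (site_walk \<xi>) (int j) + enat j \<le> hit (site_walk \<xi>) (int j + 1)} \<longleftrightarrow>
        \<xi> \<in> {\<xi> \<in> space joint. j \<le> W j (right_parts \<xi>)}"
      using AE_steered
    proof eventually_elim
      case (elim \<xi>)
      interpret steered_path "site_walk \<xi>" "arrows \<xi>" by fact
      show ?case using waiting_time_exceeds_iff unfolding W_def half_arrows_right_parts by simp
    qed
    show "{\<xi> \<in> space joint. hit (site_walk \<xi>) (int j) + enat j \<le> hit (site_walk \<xi>) (int j + 1)} \<in> sets joint"
      using measurable_compose[OF site_walk_joint hit_event_measurable] by simp
    show "{\<xi> \<in> space joint. j \<le> W j (right_parts \<xi>)} \<in> sets joint"
      using measurable_compose[OF right_parts_measurable W_measurable] by measurable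
  qed
  also have "\<dots> = q j" unfolding q_def by (rule emeasure_half[symmetric]) measurable
  finally show ?thesis .
qed

text \<open>Stationarity replaces the increment at each site \<open>i\<close> by one at the origin,
  and what remains is a telescoping sum of increments of \<open>V\<close>.\<close>

lemma nn_integral_W: "(\<integral>\<^sup>+\<zeta>. of_nat (W k \<zeta>) \<partial>half) = (\<integral>\<^sup>+\<zeta>. of_nat (V (Suc k) \<zeta>) \<partial>half)"
proof -
  have "(\<integral>\<^sup>+\<zeta>. of_nat (W k \<zeta>) \<partial>half) =
      (\<integral>\<^sup>+\<zeta>. (\<Sum>i\<le>k. of_nat (V (Suc k - i) ((shift2 ^^ i) \<zeta>) - V (k - i) ((shift2 ^^ i) \<zeta>))) \<partial>half)"
    by (simp add: W_eq)
  also have "\<dots> = (\<Sum>i\<le>k. \<integral>\<^sup>+\<zeta>. of_nat (V (Suc k - i) ((shift2 ^^ i) \<zeta>) - V (k - i) ((shift2 ^^ i) \<zeta>)) \<partial>half)"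
    by (rule nn_integral_sum) measurable
  also have "\<dots> = (\<Sum>i\<le>k. \<integral>\<^sup>+\<zeta>. of_nat (V (Suc k - i) \<zeta> - V (k - i) \<zeta>) \<partial>half)"
    by (intro sum.cong refl H.nn_integral_funpow[where f = "\<lambda>\<zeta>. of_nat (V _ \<zeta> - V _ \<zeta>)"]) measurable
  also have "\<dots> = (\<Sum>i\<le>k. \<integral>\<^sup>+\<zeta>. of_nat (V (Suc i) \<zeta> - V i \<zeta>) \<partial>half)"
    by (rule sum.reindex_bij_witness[of _ "\<lambda>i. k - i" "\<lambda>i. k - i"]) (auto simp: Suc_diff_le)
  also have "\<dots> = (\<integral>\<^sup>+\<zeta>. (\<Sum>i\<le>k. of_nat (V (Suc i) \<zeta> - V i \<zeta>)) \<partial>half)"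
    by (rule nn_integral_sum[symmetric]) measurable
  also have "\<dots> = (\<integral>\<^sup>+\<zeta>. of_nat (V (Suc k) \<zeta>) \<partial>half)"
  proof (rule nn_integral_cong_AE)
    show "AE \<zeta> in half. (\<Sum>i\<le>k. of_nat (V (Suc i) \<zeta> - V i \<zeta>)) = (of_nat (V (Suc k) \<zeta>) :: ennreal)"
      using AE_V_mono
    proof eventually_elim
      case (elim \<zeta>)
      \<comment> \<open>Monotonicity makes the differences of natural numbers genuine, so that they
        telescope.\<close>
      then have mono: "V m \<zeta> \<le> V (Suc m) \<zeta>" for m using elim[rule_format, of m 0] by simp
      have "(\<Sum>i\<le>k. V (Suc i) \<zeta> - V i \<zeta>) = V (Suc k) \<zeta>" for k
        by (induction k) (use mono in auto)
      then show ?case by (metis of_nat_sum)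
    qed
  qed
  finally show ?thesis .
qed

text \<open>By the tail formula the mean of \<open>W k\<close> is a series whose first
  \<open>k\<close> terms are those of \<open>q\<close> and whose other terms are at most those of
  \<open>q\<close>. It lies between a partial sum and the whole series, which may be
  infinite.\<close>

lemma expected_visits_tendsto:
  "(\<lambda>k. \<integral>\<^sup>+\<zeta>. of_nat (V (Suc k) \<zeta>) \<partial>half) \<longlonglongrightarrow> (\<Sum>j. q (Suc j))"
proof (rule tendsto_sandwich)
  have eq: "(\<integral>\<^sup>+\<zeta>. of_nat (V (Suc k) \<zeta>) \<partial>half) = (\<Sum>t. emeasure half {\<zeta> \<in> space half. Suc t \<le> W k \<zeta>})" for k
    unfolding nn_integral_W[symmetric] by (subst nn_integral_nat_function) (auto simp: Suc_le_eq)
  have le: "emeasure half {\<zeta> \<in> space half. Suc t \<le> W k \<zeta>} \<le> q (Suc t)" for t k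
    using W_tail_eq[of "Suc t" k] W_tail_le[of k "Suc t"] by (cases "Suc t \<le> k") auto
  show "eventually (\<lambda>k. (\<integral>\<^sup>+\<zeta>. of_nat (V (Suc k) \<zeta>) \<partial>half) \<le> (\<Sum>j. q (Suc j))) sequentially"
    unfolding eq by (intro always_eventually allI suminf_le le) auto
  show "eventually (\<lambda>k. (\<Sum>t<k. q (Suc t)) \<le> (\<integral>\<^sup>+\<zeta>. of_nat (V (Suc k) \<zeta>) \<partial>half)) sequentially"
  proof (intro always_eventually allI)
    fix k
    have "(\<Sum>t<k. q (Suc t)) = (\<Sum>t<k. emeasure half {\<zeta> \<in> space half. Suc t \<le> W k \<zeta>})"
      by (intro sum.cong refl W_tail_eq[symmetric]) simp
    also have "\<dots> \<le> (\<Sum>t. emeasure half {\<zeta> \<in> space half. Suc t \<le> W k \<zeta>})"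
      by (intro sum_le_suminf) auto
    finally show "(\<Sum>t<k. q (Suc t)) \<le> (\<integral>\<^sup>+\<zeta>. of_nat (V (Suc k) \<zeta>) \<partial>half)" unfolding eq .
  qed
  show "(\<lambda>k. \<Sum>t<k. q (Suc t)) \<longlonglongrightarrow> (\<Sum>j. q (Suc j))" by (rule summable_LIMSEQ) simp
qed simp

section \<open>Almost sure growth of the visit sums\<close>

definition u :: ennreal where "u = (\<Sum>j. q (Suc j))"

text \<open>Truncation at \<open>c\<close> gives an integrable function even if the mean of
  \<open>V m\<close> is infinite; monotone convergence ensures that little is lost.\<close>

lemma truncated_mean_exceeds:
  assumes "ennreal r < u" "0 \<le> r"
  shows "\<exists>m c. r < H.expectation (\<lambda>\<zeta>. real (min (V m \<zeta>) c))"
proof -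
  have "eventually (\<lambda>k. ennreal r < (\<integral>\<^sup>+\<zeta>. of_nat (V (Suc k) \<zeta>) \<partial>half)) sequentially"
    using order_tendstoD(1)[OF expected_visits_tendsto] assms(1) by (simp add: u_def)
  then obtain m where m: "ennreal r < (\<integral>\<^sup>+\<zeta>. of_nat (V m \<zeta>) \<partial>half)"
    unfolding eventually_sequentially by blast
  have "(\<integral>\<^sup>+\<zeta>. of_nat (V m \<zeta>) \<partial>half) = (\<integral>\<^sup>+\<zeta>. (SUP c. of_nat (min (V m \<zeta>) c)) \<partial>half)"
  proof (rule nn_integral_cong)
    fix \<zeta>
    show "(of_nat (V m \<zeta>) :: ennreal) = (SUP c. of_nat (min (V m \<zeta>) c))"
    proof (rule antisym)
      show "(of_nat (V m \<zeta>) :: ennreal) \<le> (SUP c. of_nat (min (V m \<zeta>) c))"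
        by (rule SUP_upper2[of "V m \<zeta>"]) auto
    qed (intro SUP_least, simp)
  qed
  also have "\<dots> = (SUP c. \<integral>\<^sup>+\<zeta>. of_nat (min (V m \<zeta>) c) \<partial>half)"
  proof (rule nn_integral_monotone_convergence_SUP)
    show "incseq (\<lambda>c \<zeta>. of_nat (min (V m \<zeta>) c) :: ennreal)"
      by (auto simp: incseq_def le_fun_def)
  qed measurable
  finally obtain c where c: "ennreal r < (\<integral>\<^sup>+\<zeta>. of_nat (min (V m \<zeta>) c) \<partial>half)"
    using m by (auto simp: less_SUP_iff)
  have "(\<integral>\<^sup>+\<zeta>. of_nat (min (V m \<zeta>) c) \<partial>half) = (\<integral>\<^sup>+\<zeta>. ennreal (real (min (V m \<zeta>) c)) \<partial>half)"
    by (simp only: ennreal_of_nat_eq_real_of_nat)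
  also have "\<dots> = ennreal (H.expectation (\<lambda>\<zeta>. real (min (V m \<zeta>) c)))"
    by (rule nn_integral_eq_integral, rule H.integrable_const_bound[of _ "real c"]) auto
  finally have "ennreal r < ennreal (H.expectation (\<lambda>\<zeta>. real (min (V m \<zeta>) c)))" using c by simp
  then have "r < H.expectation (\<lambda>\<zeta>. real (min (V m \<zeta>) c))"
    using assms(2) by (simp add: ennreal_less_iff)
  then show ?thesis by blast
qed

text \<open>Every site except the last \<open>m\<close> contributes at least the truncated
  \<open>V m\<close>, whose Birkhoff sums grow at a rate above \<open>r\<close>.\<close>

lemma visits_sum_lower:
  assumes r: "ennreal r < u" "0 \<le> r"
  shows "AE \<zeta> in half. eventually (\<lambda>k. r * real k \<le> real (\<Sum>x<k. V (k - x) ((shift2 ^^ x) \<zeta>))) sequentially"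
proof -
  obtain m c where mc: "r < H.expectation (\<lambda>\<zeta>. real (min (V m \<zeta>) c))"
    using truncated_mean_exceeds[OF r] by blast
  define f where "f \<zeta> = real (min (V m \<zeta>) c)" for \<zeta>
  \<comment> \<open>Half of the gap goes to the error in the ergodic theorem; the other half makes
    up for the \<open>m\<close> sites left out.\<close>
  define e where "e = (H.expectation f - r) / 2"
  have int_f: "integrable half f"
    unfolding f_def by (rule H.integrable_const_bound[of _ "real c"]) auto
  have e: "0 < e" using mc by (simp add: e_def f_def[abs_def])
  have "AE \<zeta> in half. eventually (\<lambda>n. H.birkhoff_sum (\<lambda>\<zeta>. - f \<zeta>) n \<zeta> \<le> real n * (H.expectation (\<lambda>\<zeta>. - f \<zeta>) + e)) sequentially"
    using int_f e by (intro H.birkhoff_upper) auto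
  then show ?thesis using AE_V_mono
  proof eventually_elim
    case (elim \<zeta>)
    have mono: "V k ((shift2 ^^ x) \<zeta>) \<le> V l ((shift2 ^^ x) \<zeta>)" if "k \<le> l" for k l x
      by (rule lift_Suc_mono_le[of "\<lambda>k. V k ((shift2 ^^ x) \<zeta>)", OF _ that]) (use elim(2) in blast)
    have Ef: "H.expectation (\<lambda>\<zeta>. - f \<zeta>) + e = - (r + e)"
      by (simp add: e_def field_simps)
    have "eventually (\<lambda>n. real n * (r + e) \<le> (\<Sum>x<n. f ((shift2 ^^ x) \<zeta>))) sequentially"
      using elim(1)
    proof (rule eventually_mono)
      fix n assume "H.birkhoff_sum (\<lambda>\<zeta>. - f \<zeta>) n \<zeta> \<le> real n * (H.expectation (\<lambda>\<zeta>. - f \<zeta>) + e)"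
      then have "- (\<Sum>x<n. f ((shift2 ^^ x) \<zeta>)) \<le> - (real n * (r + e))"
        unfolding Ef H.birkhoff_sum_def sum_negf by (simp only: mult_minus_right)
      then show "real n * (r + e) \<le> (\<Sum>x<n. f ((shift2 ^^ x) \<zeta>))" by (simp only: neg_le_iff_le)
    qed
    then obtain n0 where n0: "\<And>n. n \<ge> n0 \<Longrightarrow> real n * (r + e) \<le> (\<Sum>x<n. f ((shift2 ^^ x) \<zeta>))"
      unfolding eventually_sequentially by blast
    \<comment> \<open>From \<open>n1\<close> on the gain \<open>k * e\<close> outweighs the loss
      \<open>m * (r + e)\<close> from the omitted sites.\<close>
    obtain n1 :: nat where n1: "real m * (r + e) / e \<le> real n1" using real_arch_simple by blast
    show ?case
    proof (rule eventually_sequentiallyI[of "n0 + n1 + m"])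
      fix k assume k: "n0 + n1 + m \<le> k"
      have "real m * (r + e) \<le> real k * e"
      proof -
        have "real m * (r + e) / e \<le> real k" using n1 k by simp
        then show ?thesis using e by (simp add: field_simps)
      qed
      then have "r * real k \<le> real (k - m) * (r + e)" using k by (simp add: of_nat_diff algebra_simps)
      also have "\<dots> \<le> (\<Sum>x<k - m. f ((shift2 ^^ x) \<zeta>))" by (rule n0) (use k in simp)
      also have "\<dots> \<le> (\<Sum>x<k - m. real (V (k - x) ((shift2 ^^ x) \<zeta>)))"
      proof (rule sum_mono)
        fix x assume "x \<in> {..<k - m}"
        then have "V m ((shift2 ^^ x) \<zeta>) \<le> V (k - x) ((shift2 ^^ x) \<zeta>)" by (intro mono) auto
        then show "f ((shift2 ^^ x) \<zeta>) \<le> real (V (k - x) ((shift2 ^^ x) \<zeta>))" by (simp add: f_def)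
      qed
      also have "\<dots> \<le> (\<Sum>x<k. real (V (k - x) ((shift2 ^^ x) \<zeta>)))" by (rule sum_mono2) auto
      finally show "r * real k \<le> real (\<Sum>x<k. V (k - x) ((shift2 ^^ x) \<zeta>))" by simp
    qed
  qed
qed

text \<open>A bound for all \<open>V m\<close> that depends on no level, so that its Birkhoff sums
  dominate the visit sums. Values in \<open>ennreal\<close> allow for recurrence.\<close>

definition total_visits :: "(nat \<Rightarrow> nat \<Rightarrow> real) \<times> (nat \<Rightarrow> nat \<Rightarrow> real) \<Rightarrow> ennreal" where
  "total_visits \<zeta> = (SUP m. of_nat (V (Suc m) \<zeta>))"

lemma total_visits_measurable [measurable]: "total_visits \<in> borel_measurable half"
  unfolding total_visits_def[abs_def] by measurable

lemma nn_integral_total_visits: "(\<integral>\<^sup>+\<zeta>. total_visits \<zeta> \<partial>half) = u"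
proof -
  have "(\<integral>\<^sup>+\<zeta>. total_visits \<zeta> \<partial>half) = (SUP m. \<integral>\<^sup>+\<zeta>. of_nat (V (Suc m) \<zeta>) \<partial>half)"
    unfolding total_visits_def
  proof (rule nn_integral_monotone_convergence_SUP_AE)
    show "AE \<zeta> in half. (of_nat (V (Suc i) \<zeta>) :: ennreal) \<le> of_nat (V (Suc (Suc i)) \<zeta>)" for i
      using AE_V_mono by eventually_elim (metis funpow_0 of_nat_mono)
  qed measurable
  also have "\<dots> = u"
  proof (rule LIMSEQ_unique)
    have "incseq (\<lambda>m. \<integral>\<^sup>+\<zeta>. of_nat (V (Suc m) \<zeta>) \<partial>half)"
    proof (rule incseq_SucI, rule nn_integral_mono_AE)
      show "AE \<zeta> in half. (of_nat (V (Suc i) \<zeta>) :: ennreal) \<le> of_nat (V (Suc (Suc i)) \<zeta>)" for i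
        using AE_V_mono by eventually_elim (metis funpow_0 of_nat_mono)
    qed
    then show "(\<lambda>m. \<integral>\<^sup>+\<zeta>. of_nat (V (Suc m) \<zeta>) \<partial>half) \<longlonglongrightarrow> (SUP m. \<integral>\<^sup>+\<zeta>. of_nat (V (Suc m) \<zeta>) \<partial>half)"
      by (rule LIMSEQ_SUP)
    show "(\<lambda>m. \<integral>\<^sup>+\<zeta>. of_nat (V (Suc m) \<zeta>) \<partial>half) \<longlonglongrightarrow> u"
      unfolding u_def by (rule expected_visits_tendsto)
  qed
  finally show ?thesis .
qed

text \<open>For finite \<open>u\<close> the function \<open>total_visits\<close> is integrable with
  mean \<open>u\<close>, and the ergodic theorem applies to it. Being finite almost surely, it also
  bounds the visits to the origin, which controls the time at negative sites.\<close>

lemma visits_sum_upper: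
  assumes fin: "u < \<infinity>" and "0 < e"
  shows "AE \<zeta> in half. eventually (\<lambda>k. real (\<Sum>x<k. V (k - x) ((shift2 ^^ x) \<zeta>)) \<le> (enn2real u + e) * real k) sequentially"
    and "AE \<zeta> in half. \<exists>B. \<forall>k. V k \<zeta> \<le> B"
proof -
  define g where "g \<zeta> = enn2real (total_visits \<zeta>)" for \<zeta>
  have g [measurable]: "g \<in> borel_measurable half" unfolding g_def by measurable
  have finite: "AE \<zeta> in half. total_visits \<zeta> \<noteq> \<infinity>"
    using fin by (intro nn_integral_PInf_AE) (auto simp: nn_integral_total_visits)
  have "(\<integral>\<^sup>+\<zeta>. ennreal (g \<zeta>) \<partial>half) = (\<integral>\<^sup>+\<zeta>. total_visits \<zeta> \<partial>half)"
    using finite by (intro nn_integral_cong_AE, eventually_elim) (auto simp: g_def less_top)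
  then have ng: "(\<integral>\<^sup>+\<zeta>. ennreal (g \<zeta>) \<partial>half) = u" by (simp add: nn_integral_total_visits)
  have int_g: "integrable half g"
    using fin ng by (intro integrableI_nonneg) (auto simp: g_def)
  have Eg: "H.expectation g = enn2real u"
    using ng by (subst integral_eq_nn_integral) (auto simp: g_def)
  have bound: "AE \<zeta> in half. \<forall>k. real (V k \<zeta>) \<le> g \<zeta>"
    using finite
  proof eventually_elim
    case (elim \<zeta>)
    show ?case
    proof
      fix k
      show "real (V k \<zeta>) \<le> g \<zeta>"
      proof (cases k)
        case (Suc m)
        have "of_nat (V (Suc m) \<zeta>) \<le> total_visits \<zeta>" unfolding total_visits_def by (rule SUP_upper) simp
        then have "ennreal (real (V (Suc m) \<zeta>)) \<le> ennreal (g \<zeta>)"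
          using elim by (simp add: g_def ennreal_of_nat_eq_real_of_nat less_top)
        then show ?thesis using Suc by (simp add: g_def)
      qed (simp add: g_def)
    qed
  qed
  show "AE \<zeta> in half. \<exists>B. \<forall>k. V k \<zeta> \<le> B"
    using bound
  proof eventually_elim
    case (elim \<zeta>)
    obtain B :: nat where "g \<zeta> \<le> real B" using real_arch_simple by blast
    then have "\<forall>k. V k \<zeta> \<le> B" using elim order_trans of_nat_le_iff by blast
    then show ?case by blast
  qed
  show "AE \<zeta> in half. eventually (\<lambda>k. real (\<Sum>x<k. V (k - x) ((shift2 ^^ x) \<zeta>)) \<le> (enn2real u + e) * real k) sequentially"
    using H.birkhoff_upper[OF int_g \<open>0 < e\<close>] H.AE_funpow[OF bound]
  proof eventually_elim
    case (elim \<zeta>)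
    show ?case
      using elim(1)
    proof (rule eventually_mono)
      fix k assume k: "H.birkhoff_sum g k \<zeta> \<le> real k * (H.expectation g + e)"
      have "real (\<Sum>x<k. V (k - x) ((shift2 ^^ x) \<zeta>)) \<le> H.birkhoff_sum g k \<zeta>"
        unfolding H.birkhoff_sum_def of_nat_sum by (rule sum_mono) (use elim(2) in blast)
      also note k
      finally show "real (\<Sum>x<k. V (k - x) ((shift2 ^^ x) \<zeta>)) \<le> (enn2real u + e) * real k"
        by (simp add: Eg mult.commute)
    qed
  qed
qed

section \<open>The speed of the site-driven walk\<close>

lemma time_eq_V:
  assumes "steered_path (site_walk \<xi>) (arrows \<xi>)"
  shows "upward_path.T (site_walk \<xi>) k = (\<Sum>x<k. V (k - x) ((shift2 ^^ x) (right_parts \<xi>))) +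
    card {m. m < upward_path.T (site_walk \<xi>) k \<and> site_walk \<xi> m < 0}"
proof -
  interpret steered_path "site_walk \<xi>" "arrows \<xi>" by fact
  show ?thesis
    using time_eq[of k] unfolding V_def half_arrows_right_parts funpow_shift_half_arrows .
qed

text \<open>Passing from level \<open>1\<close> to level \<open>2\<close> takes at least one step,
  so the first term of the series is already \<open>1\<close>.\<close>

lemma u_ge_1: "1 \<le> u"
proof -
  have "AE \<zeta> in half. Suc 0 \<le> W (Suc 0) \<zeta>"
  proof (rule AE_half)
    show "AE \<xi> in joint. Suc 0 \<le> W (Suc 0) (right_parts \<xi>)"
      using AE_steered
    proof eventually_elim
      case (elim \<xi>)
      interpret steered_path "site_walk \<xi>" "arrows \<xi>" by fact
      have "hit (site_walk \<xi>) (int 1) + enat 1 \<le> hit (site_walk \<xi>) (int 1 + 1)"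
        using T_mono[of 1 2] hit_eq[of 1] hit_eq[of 2] by simp
      then show ?case
        using waiting_time_exceeds_iff[of 1] unfolding W_def half_arrows_right_parts by simp
    qed
  qed measurable
  then have "q (Suc 0) = emeasure half (space half)"
    unfolding q_def by (intro emeasure_eq_AE) auto
  then have "1 = (\<Sum>j<1. q (Suc j))" by (simp add: H.emeasure_space_1)
  also have "\<dots> \<le> u" unfolding u_def by (rule sum_le_suminf) auto
  finally show ?thesis .
qed

lemma site_walk_speed:
  "AE \<xi> in joint. (\<lambda>n. real_of_int (site_walk \<xi> n) / real n) \<longlonglongrightarrow> enn2real (1 / u)"
proof (cases "u < \<infinity>")
  case False
  then have u: "u = \<infinity>" using less_top[of u] by (metis infinity_ennreal_def)
  have good: "AE \<xi> in joint. good_path (site_walk \<xi>)"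
    using AE_good_cwalk[OF prob_space_axioms sets_Pe cookies]
    by (subst (asm) AE_walks_iff) measurable
  have "AE \<zeta> in half. \<forall>c::nat. eventually (\<lambda>k. real c * real k \<le> real (\<Sum>x<k. V (k - x) ((shift2 ^^ x) \<zeta>))) sequentially"
    unfolding AE_all_countable using u by (intro allI visits_sum_lower) auto
  from AE_joint[OF this] good AE_steered show ?thesis
  proof eventually_elim
    case (elim \<xi>)
    interpret steered_path "site_walk \<xi>" "arrows \<xi>" by fact
    have "eventually (\<lambda>k. real c * real k \<le> real (T k)) sequentially" for c :: nat
      using elim(1)[rule_format, of c]
    proof (rule eventually_mono)
      fix k assume "real c * real k \<le> real (\<Sum>x<k. V (k - x) ((shift2 ^^ x) (right_parts \<xi>)))"
      also have "\<dots> \<le> real (T k)" using time_eq_V[OF elim(3), of k] by linarith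
      finally show "real c * real k \<le> real (T k)" .
    qed
    then have "(\<lambda>n. real_of_int (site_walk \<xi> n) / real n) \<longlonglongrightarrow> 0"
      using elim(2) by (intro speed_zero) (auto simp: good_path_def)
    \<comment> \<open>In \<open>ennreal\<close> the quotient \<open>1 / u\<close> is
      \<open>0\<close> for infinite \<open>u\<close>, in accordance with the convention on the
      speed.\<close>
    then show ?case by (simp add: u)
  qed
next
  case True
  define w where "w = enn2real u"
  have u: "u = ennreal w" using True by (simp add: w_def)
  have w: "1 \<le> w" using u_ge_1 unfolding u by simp
  \<comment> \<open>Countably many rates suffice, so their exceptional null sets can be united.
    Since \<open>w\<close> is at least \<open>1\<close>, all of these rates are nonnegative, as
    \<open>visits_sum_lower\<close> requires.\<close>
  have "AE \<zeta> in half. \<forall>i::nat. eventually (\<lambda>k. (w - 1 / real (Suc i)) * real k \<le> real (\<Sum>x<k. V (k - x) ((shift2 ^^ x) \<zeta>))) sequentially"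
    unfolding AE_all_countable
  proof
    fix i
    have "1 / real (Suc i) \<le> 1" "0 < 1 / real (Suc i)" by simp_all
    then have "0 \<le> w - 1 / real (Suc i)" "w - 1 / real (Suc i) < w" using w by linarith+
    then show "AE \<zeta> in half. eventually (\<lambda>k. (w - 1 / real (Suc i)) * real k \<le> real (\<Sum>x<k. V (k - x) ((shift2 ^^ x) \<zeta>))) sequentially"
      by (intro visits_sum_lower) (simp_all only: u ennreal_less_iff)
  qed
  moreover have "AE \<zeta> in half. \<forall>i::nat. eventually (\<lambda>k. real (\<Sum>x<k. V (k - x) ((shift2 ^^ x) \<zeta>)) \<le> (w + 1 / real (Suc i)) * real k) sequentially"
    unfolding AE_all_countable w_def by (intro allI visits_sum_upper(1)[OF True]) simp
  moreover have "AE \<zeta> in half. \<exists>B. \<forall>k. V k \<zeta> \<le> B"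
    by (rule visits_sum_upper(2)[OF True zero_less_one])
  ultimately have "AE \<zeta> in half. (\<forall>i::nat. eventually (\<lambda>k. (w - 1 / real (Suc i)) * real k \<le> real (\<Sum>x<k. V (k - x) ((shift2 ^^ x) \<zeta>))) sequentially) \<and>
      (\<forall>i::nat. eventually (\<lambda>k. real (\<Sum>x<k. V (k - x) ((shift2 ^^ x) \<zeta>)) \<le> (w + 1 / real (Suc i)) * real k) sequentially) \<and>
      (\<exists>B. \<forall>k. V k \<zeta> \<le> B)"
    by eventually_elim blast
  from AE_joint[OF this] AE_steered show ?thesis
  proof eventually_elim
    case (elim \<xi>)
    interpret steered_path "site_walk \<xi>" "arrows \<xi>" by fact
    define S where "S k = (\<Sum>x<k. V (k - x) ((shift2 ^^ x) (right_parts \<xi>)))" for k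
    have low: "eventually (\<lambda>k. (w - 1 / real (Suc i)) * real k \<le> real (S k)) sequentially"
      and up: "eventually (\<lambda>k. real (S k) \<le> (w + 1 / real (Suc i)) * real k) sequentially" for i
      using elim(1) unfolding S_def by blast+
    obtain B where B: "\<And>k. V k (right_parts \<xi>) \<le> B" using elim(1) by blast
    \<comment> \<open>The bound on \<open>V\<close> limits the visits to \<open>0\<close>, hence the
      time at negative sites, so \<open>T k\<close> and the visit sum \<open>S k\<close> differ by
      at most a constant.\<close>
    have "visits (site_walk \<xi>) 0 (T k) \<le> B" for k
      using visits_T[of 0 k] B[of k] unfolding V_def half_arrows_right_parts by simp
    then obtain N where N: "\<And>k. card {m. m < T k \<and> site_walk \<xi> m < 0} \<le> N"
      using negative_time_bounded by blast
    have TS: "S k \<le> T k" "T k \<le> S k + N" for k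
      using time_eq_V[OF elim(2), of k] N[of k] unfolding S_def by linarith+
    have Slim: "(\<lambda>k. real (S k) / real k) \<longlonglongrightarrow> w"
    proof (rule LIMSEQ_I)
      fix e :: real assume "0 < e"
      then obtain i :: nat where i: "1 / real (Suc i) < e" using nat_approx_posE by blast
      have "eventually (\<lambda>k. norm (real (S k) / real k - w) < e) sequentially"
        using low[of i] up[of i] eventually_ge_at_top[of 1]
      proof eventually_elim
        case (elim k)
        have "w - 1 / real (Suc i) \<le> real (S k) / real k" "real (S k) / real k \<le> w + 1 / real (Suc i)"
          using elim by (simp_all add: pos_le_divide_eq pos_divide_le_eq del: of_nat_Suc)
        then show ?case using i by (simp add: abs_less_iff)
      qed
      then show "\<exists>no. \<forall>n\<ge>no. norm (real (S n) / real n - w) < e" by (simp add: eventually_sequentially)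
    qed
    have "(\<lambda>k. real (S k) / real k + real N / real k) \<longlonglongrightarrow> w + 0"
      by (intro tendsto_add Slim lim_const_over_n)
    then have Slim': "(\<lambda>k. real (S k) / real k + real N / real k) \<longlonglongrightarrow> w" by simp
    have "(\<lambda>k. real (T k) / real k) \<longlonglongrightarrow> w"
    proof (rule tendsto_sandwich[OF _ _ Slim Slim'])
      show "eventually (\<lambda>k. real (S k) / real k \<le> real (T k) / real k) sequentially"
        using TS(1) by (intro always_eventually allI divide_right_mono) auto
      have "real (T k) / real k \<le> real (S k) / real k + real N / real k" for k
        unfolding add_divide_distrib[symmetric]
        using TS(2)[of k] by (intro divide_right_mono) (simp_all flip: of_nat_add)
      then show "eventually (\<lambda>k. real (T k) / real k \<le> real (S k) / real k + real N / real k) sequentially"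
        by simp
    qed
    then have "(\<lambda>n. real_of_int (site_walk \<xi> n) / real n) \<longlonglongrightarrow> 1 / w"
      using w by (intro speed_finite) auto
    moreover have "enn2real (1 / u) = 1 / w"
      using w unfolding u by (simp add: divide_ennreal flip: ennreal_1)
    ultimately show ?case by simp
  qed
qed

end

theorem mainTheorem13:
  fixes Pe :: "env measure"
  assumes "prob_space Pe"
    and "sets Pe = sets env_space"
    and "AE \<omega> in Pe. \<forall>x. \<forall>i\<ge>1. \<omega> x i \<in> {1/2..1}"
    and "stationary_ergodic_right Pe"
  defines "u \<equiv> (\<Sum>j. emeasure (annealed Pe)
              {\<xi> \<in> space (annealed Pe).
                 hit (cwalk (fst \<xi>) (snd \<xi>) 0) (int (Suc j) + 1)
                   \<ge> hit (cwalk (fst \<xi>) (snd \<xi>) 0) (int (Suc j)) + enat (Suc j)})"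
  defines "v \<equiv> enn2real (1 / u)"
  shows "1 \<le> u \<and> 0 \<le> v \<and>
         (AE \<xi> in annealed Pe.
            (\<lambda>n. real_of_int (cwalk (fst \<xi>) (snd \<xi>) 0 n) / real n) \<longlonglongrightarrow> v)"
proof -
  interpret C: cookie_environment Pe
    using assms(1-4) by (simp add: cookie_environment_def cookie_environment_axioms_def)
  have u: "u = C.u"
    unfolding u_def C.u_def C.waiting_time_prob ..
  have "AE \<xi> in annealed Pe. (\<lambda>n. real_of_int (cwalk (fst \<xi>) (snd \<xi>) 0 n) / real n) \<longlonglongrightarrow> v"
    using C.site_walk_speed unfolding v_def u
    by (subst C.AE_walks_iff[where P = "\<lambda>w. (\<lambda>n. real_of_int (w n) / real n) \<longlonglongrightarrow> _"]) measurable
  then show ?thesis using C.u_ge_1 by (simp add: u v_def)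
qed

end
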